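(* Let $0<\mu<L$, $\kappa=\mu/L$, $(\gamma,\beta)\in\Omega_{\mathrm{cv}}(\mathcal Q_{\mu,L})$ and let $K\ge2$ be an integer. The following statements are equivalent: (i) there exist points $(x_0,\dots,x_{K-1})$ not all equal and $f\in\mathcal F_{\mu,L}$ such that $\mathrm{HB}_{\gamma,\beta}(f)$ cycles on $(x_0,\dots,x_{K-1})$; (ii) there exist a symmetric positive semidefinite $G\in\mathbb R^{K\times K}$ with $G\ne0$, $G\mathbf 1_K=0$, and $F\in\mathbb R^K$ such that $\langle F,e_i-e_j\rangle\ge\langle G,M_{i,j}\rangle$ for all $i,j\in\{0,\dots,K-1\}$; (iii) there exists $\nu\in\mathbb R_{\ge0}^{\lfloor K/2\rfloor}$, $\nu\neq0$, such that $0\ge\sum_{\ell=1}^{\lfloor K/2\rfloor}\nu_\ell\langle H_\ell,M_{i,0}\rangle$ for all $i\in\{0,\dots,K-1\}$. Equivalently to (iii), with the matrix $P=\big(\langle M_{i,0},H_\ell\rangle\big)_{0\le i\le K-1,\ 1\le\ell\le\lfloor K/2\rfloor}$: there exists $\nu\in\mathbb R_{\ge0}^{\lfloor K/2\rfloor}$, $\nu\ne0$, with $P\nu\le0$ (componentwise).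
   Context: For $0<\mu\le L$, $\mathcal F_{\mu,L}$ is the set of continuously differentiable functions $f:\mathbb R^d\to\mathbb R$ ($d\ge1$ arbitrary) with $f(x)\le f(y)+\langle\nabla f(y),x-y\rangle+\frac L2\|x-y\|^2$ and $f(x)\ge f(y)+\langle\nabla f(y),x-y\rangle+\frac\mu2\|x-y\|^2$ for all $x,y$. For $\gamma,\beta\in\mathbb R$ and differentiable $f$, $\mathrm{HB}_{\gamma,\beta}(f)$ is the iteration $z_{t+1}=z_t-\gamma\nabla f(z_t)+\beta(z_t-z_{t-1})$, $t\ge1$, from initial points $z_0,z_1$; it cycles on $(x_0,\dots,x_{K-1})$ (not all equal) if the sequence initialized at $z_0=x_0,z_1=x_1$ satisfies $z_t=x_{t\bmod K}$ for all $t\ge0$. $\Omega_{\mathrm{cv}}(\mathcal Q_{\mu,L})=\{(\gamma,\beta):\beta\in(-1,1),\ 0<\gamma<\frac2L(1+\beta)\}$. $e_0,\dots,e_{K-1}$ is the canonical basis of $\mathbb R^K$ (indices taken modulo $K$), $\mathbf 1_K$ the all-ones vector, $\langle A,B\rangle=\mathrm{Tr}(A^\top B)$ for matrices. Put $a_i=\frac{(1+\beta)e_i-e_{i+1}-\beta e_{i-1}}{\gamma}$. The matrices $M_{i,j}$ are the symmetric matrices $$M_{i,j}=\tfrac12\big(a_j(e_i-e_j)^\top+(e_i-e_j)a_j^\top\big)+\tfrac1{2L}(a_i-a_j)(a_i-a_j)^\top+\tfrac{\mu}{2(1-\kappa)}\,b_{ij}b_{ij}^\top,\qquad b_{ij}=(e_i-e_j)-\tfrac1L(a_i-a_j),$$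 so that, when $G$ is the Gram matrix of the centered points $x_i-\bar x$, $\bar x=\frac1K\sum_i x_i$, and $g_i=\frac{(1+\beta)x_i-x_{i+1}-\beta x_{i-1}}{\gamma}$, one has $\langle G,M_{i,j}\rangle=\langle g_j,x_i-x_j\rangle+\frac1{2L}\|g_i-g_j\|^2+\frac{\mu}{2(1-\kappa)}\|x_i-\frac1Lg_i-x_j+\frac1Lg_j\|^2$. Finally $H_\ell=\big(\cos(\frac{2\pi\ell}{K}|i-j|)\big)_{0\le i,j\le K-1}$. *)

theory Defs
  imports Complex_Main "Jordan_Normal_Form.Matrix"
begin

text \<open>The dimension of the ambient space is existentially quantified in the theorem, so it cannot be
  a type. The space of dimension \<open>d\<close> is the carrier set \<open>carrier_vec d\<close>, and functions on it are total
  functions on \<open>real vec\<close> whose values outside this carrier are never inspected.\<close>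

definition vnorm :: "real vec \<Rightarrow> real" where
  "vnorm v = sqrt (v \<bullet> v)"

text \<open>Frechet differentiability at \<open>x\<close>, with the derivative represented by the vector \<open>g\<close>.\<close>

definition has_gradient :: "nat \<Rightarrow> (real vec \<Rightarrow> real) \<Rightarrow> real vec \<Rightarrow> real vec \<Rightarrow> bool" where
  "has_gradient d f x g \<longleftrightarrow> g \<in> carrier_vec d \<and>
     (\<forall>\<epsilon>>0. \<exists>\<delta>>0. \<forall>y\<in>carrier_vec d. vnorm (y - x) < \<delta> \<longrightarrow>
        \<bar>f y - f x - g \<bullet> (y - x)\<bar> \<le> \<epsilon> * vnorm (y - x))"

definition grad :: "nat \<Rightarrow> (real vec \<Rightarrow> real) \<Rightarrow> real vec \<Rightarrow> real vec" where
  "grad d f x = (THE g. has_gradient d f x g)"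

lemma has_gradient_unique:
  assumes x: "x \<in> carrier_vec d" and g: "has_gradient d f x g" and h: "has_gradient d f x h"
  shows "g = h"
proof (rule ccontr)
  assume ne: "g \<noteq> h"
  define u where "u = g - h"
  have gc: "g \<in> carrier_vec d" and hc: "h \<in> carrier_vec d"
    using g h by (auto simp: has_gradient_def)
  hence uc: "u \<in> carrier_vec d" by (simp add: u_def)
  have uu: "u \<bullet> u = (\<Sum>i<d. (u $ i)\<^sup>2)"
    using uc by (simp add: scalar_prod_def power2_eq_square atLeast0LessThan)
  have "\<exists>i<d. u $ i \<noteq> 0"
  proof (rule ccontr)
    assume "\<not> ?thesis"
    hence "g = h" using gc hc by (intro eq_vecI) (auto simp: u_def)
    with ne show False by simp
  qed
  then obtain i where i: "i < d" "u $ i \<noteq> 0" by blast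
  have "0 < (u $ i)\<^sup>2" using i by simp
  also have "\<dots> \<le> (\<Sum>i<d. (u $ i)\<^sup>2)" using i by (intro member_le_sum) auto
  finally have pos: "u \<bullet> u > 0" using uu by simp
  define n where "n = vnorm u"
  have n: "n > 0" and nn: "n * n = u \<bullet> u" using pos by (simp_all add: n_def vnorm_def)
  define \<epsilon> where "\<epsilon> = n / 4"
  have e: "\<epsilon> > 0" using n by (simp add: \<epsilon>_def)
  obtain d1 where d1: "d1 > 0" "\<And>y. y \<in> carrier_vec d \<Longrightarrow> vnorm (y - x) < d1 \<Longrightarrow>
        \<bar>f y - f x - g \<bullet> (y - x)\<bar> \<le> \<epsilon> * vnorm (y - x)"
    using g e unfolding has_gradient_def by blast
  obtain d2 where d2: "d2 > 0" "\<And>y. y \<in> carrier_vec d \<Longrightarrow> vnorm (y - x) < d2 \<Longrightarrow>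
        \<bar>f y - f x - h \<bullet> (y - x)\<bar> \<le> \<epsilon> * vnorm (y - x)"
    using h e unfolding has_gradient_def by blast
  define t where "t = min d1 d2 / (2 * n)"
  have t: "t > 0" using n d1(1) d2(1) by (simp add: t_def)
  define y where "y = x + t \<cdot>\<^sub>v u"
  have yc: "y \<in> carrier_vec d" using x uc by (simp add: y_def)
  have yx: "y - x = t \<cdot>\<^sub>v u" using x uc by (auto simp: y_def)
  have "(t \<cdot>\<^sub>v u) \<bullet> (t \<cdot>\<^sub>v u) = t\<^sup>2 * (u \<bullet> u)"
    using uc by (simp add: power2_eq_square)
  hence ny: "vnorm (y - x) = t * n"
    using t by (simp add: yx vnorm_def n_def real_sqrt_mult)
  have tn: "t * n < d1" "t * n < d2" using n d1(1) d2(1) by (auto simp: t_def)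
  have gd: "g \<bullet> (y - x) = t * (g \<bullet> u)" and hd: "h \<bullet> (y - x) = t * (h \<bullet> u)"
    using gc hc uc by (simp_all add: yx)
  have "g \<bullet> u - h \<bullet> u = u \<bullet> u"
    using minus_scalar_prod_distrib[OF gc hc uc] by (simp add: u_def)
  hence "t * (g \<bullet> u) - t * (h \<bullet> u) = t * (n * n)"
    by (metis nn right_diff_distrib)
  with d1(2)[OF yc] d2(2)[OF yc] gd hd ny tn
  have "t * (n * n) \<le> 2 * (\<epsilon> * (t * n))" by auto
  also have "\<dots> = t * (n * n) / 2" by (simp add: \<epsilon>_def)
  finally show False using t n by simp
qed

corollary grad_eq:
  assumes "x \<in> carrier_vec d" "has_gradient d f x g"
  shows "grad d f x = g"
  unfolding grad_def using assms has_gradient_unique by blast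

definition C1 :: "nat \<Rightarrow> (real vec \<Rightarrow> real) \<Rightarrow> bool" where
  "C1 d f \<longleftrightarrow> (\<forall>x\<in>carrier_vec d. \<exists>g. has_gradient d f x g) \<and>
     (\<forall>x\<in>carrier_vec d. \<forall>\<epsilon>>0. \<exists>\<delta>>0. \<forall>y\<in>carrier_vec d.
        vnorm (y - x) < \<delta> \<longrightarrow> vnorm (grad d f y - grad d f x) < \<epsilon>)"

definition F_class :: "nat \<Rightarrow> real \<Rightarrow> real \<Rightarrow> (real vec \<Rightarrow> real) set" where
  "F_class d \<mu> L = {f. C1 d f \<and>
     (\<forall>x\<in>carrier_vec d. \<forall>y\<in>carrier_vec d.
        f x \<le> f y + grad d f y \<bullet> (x - y) + L / 2 * (vnorm (x - y))\<^sup>2 \<and>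
        f x \<ge> f y + grad d f y \<bullet> (x - y) + \<mu> / 2 * (vnorm (x - y))\<^sup>2)}"

fun HB :: "nat \<Rightarrow> real \<Rightarrow> real \<Rightarrow> (real vec \<Rightarrow> real) \<Rightarrow> real vec \<Rightarrow> real vec \<Rightarrow> nat \<Rightarrow> real vec" where
  "HB d \<gamma> \<beta> f z0 z1 0 = z0"
| "HB d \<gamma> \<beta> f z0 z1 (Suc 0) = z1"
| "HB d \<gamma> \<beta> f z0 z1 (Suc (Suc t)) =
     (HB d \<gamma> \<beta> f z0 z1 (Suc t) - \<gamma> \<cdot>\<^sub>v grad d f (HB d \<gamma> \<beta> f z0 z1 (Suc t)))
       + \<beta> \<cdot>\<^sub>v (HB d \<gamma> \<beta> f z0 z1 (Suc t) - HB d \<gamma> \<beta> f z0 z1 t)"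

definition HB_cycles ::
    "nat \<Rightarrow> real \<Rightarrow> real \<Rightarrow> (real vec \<Rightarrow> real) \<Rightarrow> nat \<Rightarrow> (nat \<Rightarrow> real vec) \<Rightarrow> bool" where
  "HB_cycles d \<gamma> \<beta> f K x \<longleftrightarrow>
     (\<exists>i<K. \<exists>j<K. x i \<noteq> x j) \<and> (\<forall>t. HB d \<gamma> \<beta> f (x 0) (x 1) t = x (t mod K))"

text \<open>The convergence region over quadratics does not depend on \<open>\<mu>\<close>.\<close>

definition Omega_cv_Q :: "real \<Rightarrow> real \<Rightarrow> (real \<times> real) set" where
  "Omega_cv_Q \<mu> L = {(\<gamma>, \<beta>). -1 < \<beta> \<and> \<beta> < 1 \<and> 0 < \<gamma> \<and> \<gamma> < 2 / L * (1 + \<beta>)}"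

definition ones_vec :: "nat \<Rightarrow> real vec" where
  "ones_vec K = vec K (\<lambda>_. 1)"

definition outer :: "real vec \<Rightarrow> real vec \<Rightarrow> real mat" where
  "outer u v = mat (dim_vec u) (dim_vec v) (\<lambda>(i, j). u $ i * v $ j)"

definition mat_trace :: "real mat \<Rightarrow> real" where
  "mat_trace A = (\<Sum>i<dim_row A. A $$ (i, i))"

definition mat_inner :: "real mat \<Rightarrow> real mat \<Rightarrow> real" where
  "mat_inner A B = mat_trace (transpose_mat A * B)"

definition sym_psd :: "nat \<Rightarrow> real mat \<Rightarrow> bool" where
  "sym_psd K G \<longleftrightarrow> G \<in> carrier_mat K K \<and> transpose_mat G = G \<and>
     (\<forall>v\<in>carrier_vec K. 0 \<le> v \<bullet> (G *\<^sub>v v))"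

text \<open>Canonical basis with indices modulo \<open>K\<close>; integer indices make \<open>i - 1\<close> meaningful at \<open>i = 0\<close>.\<close>

definition e_cyc :: "nat \<Rightarrow> int \<Rightarrow> real vec" where
  "e_cyc K i = unit_vec K (nat (i mod int K))"

definition a_vec :: "nat \<Rightarrow> real \<Rightarrow> real \<Rightarrow> int \<Rightarrow> real vec" where
  "a_vec K \<gamma> \<beta> i =
     (1 / \<gamma>) \<cdot>\<^sub>v ((1 + \<beta>) \<cdot>\<^sub>v e_cyc K i - e_cyc K (i + 1) - \<beta> \<cdot>\<^sub>v e_cyc K (i - 1))"

definition b_vec :: "nat \<Rightarrow> real \<Rightarrow> real \<Rightarrow> real \<Rightarrow> int \<Rightarrow> int \<Rightarrow> real vec" where
  "b_vec K L \<gamma> \<beta> i j =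
     (e_cyc K i - e_cyc K j) - (1 / L) \<cdot>\<^sub>v (a_vec K \<gamma> \<beta> i - a_vec K \<gamma> \<beta> j)"

definition M_mat :: "nat \<Rightarrow> real \<Rightarrow> real \<Rightarrow> real \<Rightarrow> real \<Rightarrow> nat \<Rightarrow> nat \<Rightarrow> real mat" where
  "M_mat K \<mu> L \<gamma> \<beta> i j =
     (let \<kappa> = \<mu> / L;
          e = (\<lambda>i. e_cyc K (int i));
          a = (\<lambda>i. a_vec K \<gamma> \<beta> (int i));
          b = b_vec K L \<gamma> \<beta> (int i) (int j)
      in (1 / 2) \<cdot>\<^sub>m (outer (a j) (e i - e j) + outer (e i - e j) (a j))
         + (1 / (2 * L)) \<cdot>\<^sub>m outer (a i - a j) (a i - a j)
         + (\<mu> / (2 * (1 - \<kappa>))) \<cdot>\<^sub>m outer b b)"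

definition H_mat :: "nat \<Rightarrow> nat \<Rightarrow> real mat" where
  "H_mat K l = mat K K (\<lambda>(i, j). cos (2 * pi * real l / real K * \<bar>real i - real j\<bar>))"

text \<open>The column index starts at \<open>0\<close>, so column \<open>l\<close> carries \<open>H\<^sub>l\<^sub>+\<^sub>1\<close>.\<close>

definition P_mat :: "nat \<Rightarrow> real \<Rightarrow> real \<Rightarrow> real \<Rightarrow> real \<Rightarrow> real mat" where
  "P_mat K \<mu> L \<gamma> \<beta> =
     mat K (K div 2) (\<lambda>(i, l). mat_inner (M_mat K \<mu> L \<gamma> \<beta> i 0) (H_mat K (l + 1)))"

end

theory Submission
  imports Defs "HOL-Analysis.Function_Topology"
begin

text \<open>The gradients along a cycle are linear in its points, so the interpolation inequalities of
  \<open>F_class\<close> are affine in the Gram matrix of the points and in the function values. Necessity of these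
  inequalities comes from comparing the upper bound at one point with the lower bound at another;
  for sufficiency, with \<open>M = L - \<mu>\<close>, the interpolating function is \<open>\<mu> / 2 * |x|\<^sup>2\<close> plus the convex hull of
  finitely many parabolas of curvature \<open>M\<close>, that is, plus the minimum over the simplex of
  \<open>M / 2 * |x - W \<lambda>|\<^sup>2 + c \<bullet> \<lambda>\<close>.

  The inequalities are invariant under simultaneous cyclic shifts. Averaging a feasible \<open>G\<close> over the shifts
  makes the function values cancel and makes \<open>G\<close> circulant; the discrete cosine transform of its first
  column is nonnegative because \<open>G\<close> is positive semidefinite, and its zeroth coefficient vanishes because
  \<open>G\<close> kills the all-ones vector. Conversely \<open>\<Sum>\<nu>\<^sub>l H\<^sub>l\<close> is the Gram matrix of the explicit points with
  coordinates \<open>sqrt \<nu>\<^sub>l * cos (2 \<pi> l i / K)\<close> and \<open>sqrt \<nu>\<^sub>l * sin (2 \<pi> l i / K)\<close>, so no factorization of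
  \<open>G\<close> is needed to close the circle of implications.\<close>

subsection \<open>Smooth strongly convex functions\<close>

lemma scalar_prod_sum: "v \<in> carrier_vec d \<Longrightarrow> u \<bullet> v = (\<Sum>k<d. u $ k * v $ k)"
  by (auto simp: scalar_prod_def atLeast0LessThan)

lemma vnorm_sq: "v \<in> carrier_vec d \<Longrightarrow> (vnorm v)\<^sup>2 = (\<Sum>k<d. (v $ k)\<^sup>2)"
  by (simp add: vnorm_def scalar_prod_sum power2_eq_square sum_nonneg)

lemma vnorm_nonneg: "0 \<le> vnorm v"
  by (simp add: vnorm_def scalar_prod_def sum_nonneg)

text \<open>The witness is the point minimizing the difference between the quadratic upper bound at \<open>x\<close>
  and the quadratic lower bound at \<open>y\<close>.\<close>

lemma interpolation_identity:
  fixes L m :: real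
  assumes "L \<noteq> 0" "m \<noteq> 0" "\<mu> = L - m" "z = (L * a - \<mu> * b - p + q) / m"
  shows "q * (z - b) + \<mu> / 2 * (z - b)\<^sup>2 - (p * (z - a) + L / 2 * (z - a)\<^sup>2) =
    q * (a - b) + 1 / (2 * L) * (p - q)\<^sup>2 + \<mu> * L / (2 * m) * ((a - b) - 1 / L * (p - q))\<^sup>2"
proof -
  define D U where "D = a - b" and "U = z - b"
  have P: "p - q = L * D - m * U" and z: "z - a = U - D"
    using assms by (auto simp: D_def U_def field_simps)
  have dl: "D - 1 / L * (L * D - m * U) = m * U / L" using assms by (simp add: field_simps)
  have "1 / (2 * L) * (L * D - m * U)\<^sup>2 = L * D\<^sup>2 / 2 - m * D * U + m\<^sup>2 * U\<^sup>2 / (2 * L)"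
    using assms(1) by (simp add: field_simps power2_eq_square)
  moreover have "\<mu> * L / (2 * m) * (m * U / L)\<^sup>2 = m * U\<^sup>2 / 2 - m\<^sup>2 * U\<^sup>2 / (2 * L)"
    using assms(1,2) by (simp add: assms(3) field_simps power2_eq_square)
  moreover have "p = L * D - m * U + q" using P by simp
  moreover have "q * U + \<mu> / 2 * U\<^sup>2 - ((L * D - m * U + q) * (U - D) + L / 2 * (U - D)\<^sup>2)
      = q * D + L * D\<^sup>2 / 2 - m * D * U + m * U\<^sup>2 / 2"
    unfolding assms(3) by (simp add: power2_eq_square field_simps)
  ultimately show ?thesis
    unfolding U_def[symmetric] D_def[symmetric] z P dl by simp
qed

text \<open>Both bounds are evaluated at one common point \<open>z\<close>. The resulting difference
  splits over the coordinates, and \<open>interpolation_identity\<close> computes each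
  summand.\<close>

lemma interpolation_inequality:
  fixes f :: "real vec \<Rightarrow> real"
  assumes "\<mu> < L" "0 < L"
    and c: "x \<in> carrier_vec d" "y \<in> carrier_vec d" "gx \<in> carrier_vec d" "gy \<in> carrier_vec d"
    and up: "\<And>z. z \<in> carrier_vec d \<Longrightarrow> f z \<le> f x + gx \<bullet> (z - x) + L / 2 * (vnorm (z - x))\<^sup>2"
    and lo: "\<And>z. z \<in> carrier_vec d \<Longrightarrow> f z \<ge> f y + gy \<bullet> (z - y) + \<mu> / 2 * (vnorm (z - y))\<^sup>2"
  shows "f x - f y \<ge> (\<Sum>k<d. gy $ k * (x $ k - y $ k) + 1 / (2 * L) * (gx $ k - gy $ k)\<^sup>2
      + \<mu> / (2 * (1 - \<mu> / L)) * ((x $ k - y $ k) - 1 / L * (gx $ k - gy $ k))\<^sup>2)"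
proof -
  define z where "z = vec d (\<lambda>k. (L * x $ k - \<mu> * y $ k - gx $ k + gy $ k) / (L - \<mu>))"
  have z: "z \<in> carrier_vec d" by (simp add: z_def)
  have "f x - f y \<ge> gy \<bullet> (z - y) + \<mu> / 2 * (vnorm (z - y))\<^sup>2
      - (gx \<bullet> (z - x) + L / 2 * (vnorm (z - x))\<^sup>2)"
    using up[OF z] lo[OF z] by linarith
  also have "gy \<bullet> (z - y) + \<mu> / 2 * (vnorm (z - y))\<^sup>2
      - (gx \<bullet> (z - x) + L / 2 * (vnorm (z - x))\<^sup>2)
    = (\<Sum>k<d. gy $ k * (z $ k - y $ k) + \<mu> / 2 * (z $ k - y $ k)\<^sup>2
      - (gx $ k * (z $ k - x $ k) + L / 2 * (z $ k - x $ k)\<^sup>2))"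
    using c z by (simp add: scalar_prod_sum[of _ d] vnorm_sq[of _ d] sum.distrib sum_subtractf sum_distrib_left)
  also have "\<dots> = (\<Sum>k<d. gy $ k * (x $ k - y $ k) + 1 / (2 * L) * (gx $ k - gy $ k)\<^sup>2
      + \<mu> / (2 * (1 - \<mu> / L)) * ((x $ k - y $ k) - 1 / L * (gx $ k - gy $ k))\<^sup>2)"
  proof (rule sum.cong[OF refl])
    fix k assume "k \<in> {..<d}"
    then have zk: "z $ k = (L * x $ k - \<mu> * y $ k - gx $ k + gy $ k) / (L - \<mu>)"
      by (simp add: z_def)
    have C: "\<mu> / (2 * (1 - \<mu> / L)) = \<mu> * L / (2 * (L - \<mu>))" using assms by (simp add: field_simps)
    show "gy $ k * (z $ k - y $ k) + \<mu> / 2 * (z $ k - y $ k)\<^sup>2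
      - (gx $ k * (z $ k - x $ k) + L / 2 * (z $ k - x $ k)\<^sup>2) =
      gy $ k * (x $ k - y $ k) + 1 / (2 * L) * (gx $ k - gy $ k)\<^sup>2
      + \<mu> / (2 * (1 - \<mu> / L)) * ((x $ k - y $ k) - 1 / L * (gx $ k - gy $ k))\<^sup>2"
      unfolding C using assms zk by (intro interpolation_identity) auto
  qed
  finally show ?thesis .
qed

section \<open>From two-sided quadratic bounds to membership in \<open>F_class\<close>\<close>

lemma has_gradient_quadratic:
  fixes f :: "real vec \<Rightarrow> real"
  assumes g: "g \<in> carrier_vec d"
    and bd: "\<And>y. y \<in> carrier_vec d \<Longrightarrow> \<bar>f y - f x - g \<bullet> (y - x)\<bar> \<le> C * (vnorm (y - x))\<^sup>2"
  shows "has_gradient d f x g"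
  unfolding has_gradient_def
proof (intro conjI allI impI g)
  fix \<epsilon> :: real assume e: "\<epsilon> > 0"
  show "\<exists>\<delta>>0. \<forall>y\<in>carrier_vec d. vnorm (y - x) < \<delta> \<longrightarrow>
      \<bar>f y - f x - g \<bullet> (y - x)\<bar> \<le> \<epsilon> * vnorm (y - x)"
  \<comment> \<open>\<open>\<bar>C\<bar> + 1\<close> is a positive denominator for every real
    \<open>C\<close>.\<close>
  proof (intro exI[of _ "\<epsilon> / (\<bar>C\<bar> + 1)"] conjI ballI impI)
    fix y assume y: "y \<in> carrier_vec d" and "vnorm (y - x) < \<epsilon> / (\<bar>C\<bar> + 1)"
    then have "(\<bar>C\<bar> + 1) * vnorm (y - x) \<le> \<epsilon>" by (simp add: field_simps)
    moreover have "C * vnorm (y - x) \<le> (\<bar>C\<bar> + 1) * vnorm (y - x)"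
      by (intro mult_right_mono vnorm_nonneg) auto
    ultimately have "C * vnorm (y - x) * vnorm (y - x) \<le> \<epsilon> * vnorm (y - x)"
      by (intro mult_right_mono vnorm_nonneg) auto
    with bd[OF y] show "\<bar>f y - f x - g \<bullet> (y - x)\<bar> \<le> \<epsilon> * vnorm (y - x)"
      by (simp add: power2_eq_square mult.assoc)
  qed (use e in auto)
qed

text \<open>The two bounds of \<open>F_class\<close> at base point \<open>x\<close>, with a
  candidate vector \<open>g\<close> in place of \<open>grad\<close>, so that they can be stated
  before differentiability is known.\<close>

definition quad_bounds :: "nat \<Rightarrow> real \<Rightarrow> real \<Rightarrow> (real vec \<Rightarrow> real) \<Rightarrow> real vec \<Rightarrow> real vec \<Rightarrow> bool" where
  "quad_bounds d \<mu> L f x g \<longleftrightarrow> g \<in> carrier_vec d \<and> (\<forall>y\<in>carrier_vec d.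
     f y \<le> f x + g \<bullet> (y - x) + L / 2 * (vnorm (y - x))\<^sup>2 \<and>
     f y \<ge> f x + g \<bullet> (y - x) + \<mu> / 2 * (vnorm (y - x))\<^sup>2)"

lemma quad_bounds_has_gradient:
  assumes "0 \<le> \<mu>" "0 \<le> L" "quad_bounds d \<mu> L f x g"
  shows "has_gradient d f x g"
proof (rule has_gradient_quadratic[where C = "L / 2"])
  show "g \<in> carrier_vec d" using assms by (simp add: quad_bounds_def)
  fix y :: "real vec" assume "y \<in> carrier_vec d"
  then have *: "f y \<le> f x + g \<bullet> (y - x) + L / 2 * (vnorm (y - x))\<^sup>2"
     "f y \<ge> f x + g \<bullet> (y - x) + \<mu> / 2 * (vnorm (y - x))\<^sup>2"
    using assms(3) by (auto simp: quad_bounds_def)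
  moreover have "0 \<le> \<mu> / 2 * (vnorm (y - x))\<^sup>2" "0 \<le> L / 2 * (vnorm (y - x))\<^sup>2" using assms by auto
  ultimately show "\<bar>f y - f x - g \<bullet> (y - x)\<bar> \<le> L / 2 * (vnorm (y - x))\<^sup>2" by linarith
qed

text \<open>Adding the interpolation inequality to its copy with the points exchanged cancels the
  function values. The nonnegative last squares are dropped, and the mixed term is absorbed by
  Young's inequality \<open>a * b \<le> b^2 / (2 * L) + L / 2 * a^2\<close>. This supplies the
  continuity of the gradient that \<open>C1\<close> demands.\<close>

lemma quad_bounds_Lipschitz:
  assumes "0 \<le> \<mu>" "\<mu> < L" and c: "x \<in> carrier_vec d" "y \<in> carrier_vec d"
    and "quad_bounds d \<mu> L f x gx" "quad_bounds d \<mu> L f y gy"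
  shows "vnorm (gx - gy) \<le> L * vnorm (x - y)"
proof -
  let ?G = "\<Sum>k<d. (gx $ k - gy $ k)\<^sup>2" and ?X = "\<Sum>k<d. (x $ k - y $ k)\<^sup>2"
  have g: "gx \<in> carrier_vec d" "gy \<in> carrier_vec d"
    using assms by (auto simp: quad_bounds_def)
  have L: "0 < L" using assms by simp
  have C: "0 \<le> \<mu> / (2 * (1 - \<mu> / L))" using assms by (simp add: field_simps)
  have 1: "f x - f y \<ge> (\<Sum>k<d. gy $ k * (x $ k - y $ k) + 1 / (2 * L) * (gx $ k - gy $ k)\<^sup>2
      + \<mu> / (2 * (1 - \<mu> / L)) * ((x $ k - y $ k) - 1 / L * (gx $ k - gy $ k))\<^sup>2)"
    using assms g L by (intro interpolation_inequality) (auto simp: quad_bounds_def)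
  have 2: "f y - f x \<ge> (\<Sum>k<d. gx $ k * (y $ k - x $ k) + 1 / (2 * L) * (gy $ k - gx $ k)\<^sup>2
      + \<mu> / (2 * (1 - \<mu> / L)) * ((y $ k - x $ k) - 1 / L * (gy $ k - gx $ k))\<^sup>2)"
    using assms g L by (intro interpolation_inequality) (auto simp: quad_bounds_def)
  have "1 / (2 * L) * ?G - L / 2 * ?X
     = (\<Sum>k<d. 1 / (2 * L) * (gx $ k - gy $ k)\<^sup>2 - L / 2 * (x $ k - y $ k)\<^sup>2)"
    by (simp add: sum_subtractf sum_distrib_left)
  also have "\<dots> \<le> (\<Sum>k<d. (gy $ k * (x $ k - y $ k) + 1 / (2 * L) * (gx $ k - gy $ k)\<^sup>2
      + \<mu> / (2 * (1 - \<mu> / L)) * ((x $ k - y $ k) - 1 / L * (gx $ k - gy $ k))\<^sup>2)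
    + (gx $ k * (y $ k - x $ k) + 1 / (2 * L) * (gy $ k - gx $ k)\<^sup>2
      + \<mu> / (2 * (1 - \<mu> / L)) * ((y $ k - x $ k) - 1 / L * (gy $ k - gx $ k))\<^sup>2))"
  proof (rule sum_mono)
    fix k
    define a b where "a = x $ k - y $ k" and "b = gx $ k - gy $ k"
    have ab: "a * b \<le> 1 / (2 * L) * b\<^sup>2 + L / 2 * a\<^sup>2"
    proof -
      have "0 \<le> (b - L * a)\<^sup>2 / (2 * L)" using L by simp
      also have "\<dots> = 1 / (2 * L) * b\<^sup>2 + L / 2 * a\<^sup>2 - a * b"
        using L by (simp add: field_simps power2_eq_square)
      finally show ?thesis by simp
    qed
    have nn: "0 \<le> \<mu> / (2 * (1 - \<mu> / L)) * (a - 1 / L * b)\<^sup>2"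
      "0 \<le> \<mu> / (2 * (1 - \<mu> / L)) * ((- a) - 1 / L * (- b))\<^sup>2"
      by (intro mult_nonneg_nonneg C zero_le_power2)+
    have *: "gy $ k * a + gx $ k * (- a) = - (a * b)" by (simp add: a_def b_def algebra_simps)
    have "1 / (2 * L) * b\<^sup>2 - L / 2 * a\<^sup>2 \<le>
      (gy $ k * a + 1 / (2 * L) * b\<^sup>2 + \<mu> / (2 * (1 - \<mu> / L)) * (a - 1 / L * b)\<^sup>2)
    + (gx $ k * (-a) + 1 / (2 * L) * (-b)\<^sup>2 + \<mu> / (2 * (1 - \<mu> / L)) * ((-a) - 1 / L * (-b))\<^sup>2)"
      using ab nn * by (simp only: power2_minus)
    moreover have "- a = y $ k - x $ k" "- b = gy $ k - gx $ k" by (auto simp: a_def b_def)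
    ultimately show "1 / (2 * L) * (gx $ k - gy $ k)\<^sup>2 - L / 2 * (x $ k - y $ k)\<^sup>2 \<le>
      (gy $ k * (x $ k - y $ k) + 1 / (2 * L) * (gx $ k - gy $ k)\<^sup>2
      + \<mu> / (2 * (1 - \<mu> / L)) * ((x $ k - y $ k) - 1 / L * (gx $ k - gy $ k))\<^sup>2)
    + (gx $ k * (y $ k - x $ k) + 1 / (2 * L) * (gy $ k - gx $ k)\<^sup>2
      + \<mu> / (2 * (1 - \<mu> / L)) * ((y $ k - x $ k) - 1 / L * (gy $ k - gx $ k))\<^sup>2)"
      by (simp only: a_def b_def)
  qed
  also have "\<dots> \<le> 0" using 1 2 by (subst sum.distrib) linarith
  finally have "?G \<le> L\<^sup>2 * ?X" using L by (simp add: field_simps power2_eq_square)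
  moreover have "(vnorm (gx - gy))\<^sup>2 = ?G" "(vnorm (x - y))\<^sup>2 = ?X"
    using c g by (simp_all add: vnorm_sq[of _ d])
  ultimately have "(vnorm (gx - gy))\<^sup>2 \<le> (L * vnorm (x - y))\<^sup>2" by (simp add: power_mult_distrib)
  then show ?thesis by (rule power2_le_imp_le) (intro mult_nonneg_nonneg less_imp_le[OF L] vnorm_nonneg)
qed

text \<open>A single vector satisfying the bounds at each point suffices: the bounds make it the
  gradient, and two such vectors at different points satisfy the Lipschitz estimate.\<close>

lemma quad_bounds_F_class:
  assumes "0 \<le> \<mu>" "\<mu> < L" and ex: "\<And>x. x \<in> carrier_vec d \<Longrightarrow> \<exists>g. quad_bounds d \<mu> L f x g"
  shows "f \<in> F_class d \<mu> L"
proof -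
  have hg: "\<exists>g. has_gradient d f x g" and qg: "quad_bounds d \<mu> L f x (grad d f x)"
    if x: "x \<in> carrier_vec d" for x
  proof -
    obtain g where g: "quad_bounds d \<mu> L f x g" using ex[OF x] by auto
    then have h: "has_gradient d f x g" using assms by (intro quad_bounds_has_gradient) auto
    then show "\<exists>g. has_gradient d f x g" by blast
    show "quad_bounds d \<mu> L f x (grad d f x)" using grad_eq[OF x h] g by simp
  qed
  have "\<exists>\<delta>>0. \<forall>y\<in>carrier_vec d. vnorm (y - x) < \<delta> \<longrightarrow> vnorm (grad d f y - grad d f x) < \<epsilon>"
    if x: "x \<in> carrier_vec d" and e: "\<epsilon> > 0" for x \<epsilon>
  proof (intro exI[of _ "\<epsilon> / L"] conjI ballI impI)
    show "0 < \<epsilon> / L" using assms e by simp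
    fix y assume y: "y \<in> carrier_vec d" and "vnorm (y - x) < \<epsilon> / L"
    then have "L * vnorm (y - x) < \<epsilon>" using assms by (simp add: field_simps)
    with quad_bounds_Lipschitz[OF assms(1,2) y x qg[OF y] qg[OF x]]
    show "vnorm (grad d f y - grad d f x) < \<epsilon>" by simp
  qed
  then show ?thesis using hg qg by (auto simp: F_class_def C1_def quad_bounds_def)
qed

text \<open>\<open>grad\<close> is a definite description, so uniqueness of gradients is what places
  its value in the carrier.\<close>

lemma F_class_quad_bounds:
  assumes "f \<in> F_class d \<mu> L" "x \<in> carrier_vec d"
  shows "quad_bounds d \<mu> L f x (grad d f x)"
proof -
  obtain g where g: "has_gradient d f x g" using assms by (auto simp: F_class_def C1_def)
  moreover from g have "g \<in> carrier_vec d" by (simp add: has_gradient_def)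
  ultimately have "grad d f x \<in> carrier_vec d" using grad_eq[OF assms(2) g] by simp
  then show ?thesis using assms by (auto simp: quad_bounds_def F_class_def)
qed

subsection \<open>Interpolation\<close>

definition std_simplex :: "nat \<Rightarrow> (nat \<Rightarrow> real) set" where
  "std_simplex N = {l. (\<forall>j<N. 0 \<le> l j) \<and> (\<forall>j\<ge>N. l j = 0) \<and> (\<Sum>j<N. l j) = 1}"

text \<open>Weights are functions on all naturals vanishing from \<open>N\<close> on. The simplex is
  thus a closed part of a product of intervals \<open>{0..1}\<close> and singletons
  \<open>{0}\<close>, which is compact by Tychonoff.\<close>

lemma compact_std_simplex: "compact (std_simplex N)"
proof -
  let ?C = "PiE UNIV (\<lambda>j. if j < N then {0..1} else {0::real})"
  have "compactin (product_topology (\<lambda>j. euclidean) UNIV) ?C"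
    by (subst compactin_PiE) auto
  then have "compact ?C" by (simp add: euclidean_product_topology)
  moreover have "closed {l::nat \<Rightarrow> real. (\<Sum>j<N. l j) = 1}"
    by (intro closed_Collect_eq continuous_intros continuous_on_product_coordinates)
  ultimately have "compact (?C \<inter> {l. (\<Sum>j<N. l j) = 1})" by (rule compact_Int_closed)
  also have "?C \<inter> {l. (\<Sum>j<N. l j) = 1} = std_simplex N"
  proof (intro equalityI subsetI)
    fix l assume l: "l \<in> std_simplex N"
    have "l j \<le> 1" if "j < N" for j
    proof -
      have "l j \<le> (\<Sum>j<N. l j)" using l that by (intro member_le_sum) (auto simp: std_simplex_def)
      then show ?thesis using l by (simp add: std_simplex_def)
    qed
    then show "l \<in> ?C \<inter> {l. (\<Sum>j<N. l j) = 1}"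
      using l by (auto simp: std_simplex_def not_less)
  next
    fix l assume l: "l \<in> ?C \<inter> {l. (\<Sum>j<N. l j) = 1}"
    then have "l \<in> ?C" by blast
    then have mem: "l j \<in> (if j < N then {0..1} else {0})" for j by (rule PiE_mem) simp
    have "0 \<le> l j" for j using mem[of j] by (auto split: if_splits)
    moreover have "l j = 0" if "N \<le> j" for j using mem[of j] that by simp
    ultimately show "l \<in> std_simplex N" using l by (simp add: std_simplex_def)
  qed
  finally show ?thesis .
qed

lemma std_simplex_segment:
  assumes "l \<in> std_simplex N" "l' \<in> std_simplex N" "0 \<le> t" "t \<le> 1"
  shows "(\<lambda>j. l j + t * (l' j - l j)) \<in> std_simplex N"
proof -
  have "0 \<le> l j + t * (l' j - l j)" if "j < N" for j
  proof -
    have "0 \<le> (1 - t) * l j + t * l' j" using assms that by (auto simp: std_simplex_def)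
    then show ?thesis by (simp add: algebra_simps)
  qed
  then show ?thesis using assms
    by (auto simp: std_simplex_def sum.distrib sum_subtractf simp flip: sum_distrib_left)
qed

lemma std_simplex_vertex: "i < N \<Longrightarrow> (\<lambda>j. if j = i then 1 else 0) \<in> std_simplex N"
  by (auto simp: std_simplex_def)

text \<open>For points \<open>w j\<close> and heights \<open>c j\<close>, the infimum of \<open>parab d N M w c x\<close> over the simplex is the convex
  hull of the parabolas \<open>M / 2 * |x - w j|\<^sup>2 + c j\<close>.\<close>

definition parab :: "nat \<Rightarrow> nat \<Rightarrow> real \<Rightarrow> (nat \<Rightarrow> nat \<Rightarrow> real) \<Rightarrow> (nat \<Rightarrow> real) \<Rightarrow> real vec \<Rightarrow> (nat \<Rightarrow> real) \<Rightarrow> real"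
  where "parab d N M w c x l =
    M / 2 * (\<Sum>k<d. (x $ k - (\<Sum>j<N. l j * w j k))\<^sup>2) + (\<Sum>j<N. l j * c j)"

definition parab_min :: "nat \<Rightarrow> nat \<Rightarrow> real \<Rightarrow> (nat \<Rightarrow> nat \<Rightarrow> real) \<Rightarrow> (nat \<Rightarrow> real) \<Rightarrow> real vec \<Rightarrow> (nat \<Rightarrow> real) \<Rightarrow> bool"
  where "parab_min d N M w c x l \<longleftrightarrow>
    l \<in> std_simplex N \<and> (\<forall>l'\<in>std_simplex N. parab d N M w c x l \<le> parab d N M w c x l')"

lemma parab_min_exists:
  assumes "N > 0" shows "\<exists>l. parab_min d N M w c x l"
proof -
  have "continuous_on (std_simplex N) (parab d N M w c x)"
    unfolding parab_def
    by (intro continuous_intros continuous_on_subset[OF continuous_on_product_coordinates]) auto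
  moreover have "std_simplex N \<noteq> {}" using std_simplex_vertex[OF assms] by auto
  ultimately show ?thesis
    using continuous_attains_inf[OF compact_std_simplex] unfolding parab_min_def by blast
qed

text \<open>The derivative at \<open>l\<close> of \<open>parab d N M w c x\<close> in the direction \<open>l' - l\<close>.\<close>

definition slack :: "nat \<Rightarrow> nat \<Rightarrow> real \<Rightarrow> (nat \<Rightarrow> nat \<Rightarrow> real) \<Rightarrow> (nat \<Rightarrow> real) \<Rightarrow> real vec \<Rightarrow> (nat \<Rightarrow> real) \<Rightarrow> (nat \<Rightarrow> real) \<Rightarrow> real"
  where "slack d N M w c x l l' =
    (\<Sum>j<N. (l' j - l j) * c j) - M * (\<Sum>k<d. (x $ k - (\<Sum>j<N. l j * w j k)) * (\<Sum>j<N. (l' j - l j) * w j k))"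

text \<open>Exact second-order expansion, jointly in the point and the weights. With
  \<open>l' = l\<close> it yields the upper bound for the interpolating function; with nonnegative
  \<open>slack\<close> and the last square bounded below by 0 it yields the lower one.\<close>

lemma parab_expand:
  "parab d N M w c y l' = parab d N M w c x l + slack d N M w c x l l'
    + M * (\<Sum>k<d. (x $ k - (\<Sum>j<N. l j * w j k)) * (y $ k - x $ k))
    + M / 2 * (\<Sum>k<d. ((y $ k - x $ k) - (\<Sum>j<N. (l' j - l j) * w j k))\<^sup>2)"
proof -
  define r where "r k = x $ k - (\<Sum>j<N. l j * w j k)" for k
  define s where "s k = (\<Sum>j<N. (l' j - l j) * w j k)" for k
  have eq: "y $ k - (\<Sum>j<N. l' j * w j k) = r k + ((y $ k - x $ k) - s k)" for k
    by (simp add: r_def s_def left_diff_distrib sum_subtractf)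
  have c: "(\<Sum>j<N. l' j * c j) = (\<Sum>j<N. l j * c j) + (\<Sum>j<N. (l' j - l j) * c j)"
    by (simp add: left_diff_distrib sum_subtractf)
  have "M / 2 * (\<Sum>k<d. (r k + ((y $ k - x $ k) - s k))\<^sup>2) =
     (\<Sum>k<d. M / 2 * (r k)\<^sup>2 + (- (M * (r k * s k)) + (M * (r k * (y $ k - x $ k))
       + M / 2 * ((y $ k - x $ k) - s k)\<^sup>2)))"
    unfolding sum_distrib_left by (intro sum.cong refl) (simp add: power2_eq_square algebra_simps)
  also have "\<dots> = M / 2 * (\<Sum>k<d. (r k)\<^sup>2) + (- (M * (\<Sum>k<d. r k * s k)) +
     (M * (\<Sum>k<d. r k * (y $ k - x $ k)) + M / 2 * (\<Sum>k<d. ((y $ k - x $ k) - s k)\<^sup>2)))"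
    by (simp add: sum.distrib sum_subtractf sum_distrib_left)
  finally show ?thesis
    unfolding parab_def slack_def eq c r_def[symmetric] s_def[symmetric] by linarith
qed

text \<open>First-order optimality of a convex quadratic on a convex set. Sufficiency is the
  expansion at a fixed point; necessity looks at the segment from \<open>l\<close> to
  \<open>l'\<close>.\<close>

lemma parab_min_iff_slack:
  assumes "0 \<le> M" "l \<in> std_simplex N"
  shows "parab_min d N M w c x l \<longleftrightarrow> (\<forall>l'\<in>std_simplex N. 0 \<le> slack d N M w c x l l')"
proof
  assume *: "\<forall>l'\<in>std_simplex N. 0 \<le> slack d N M w c x l l'"
  have "parab d N M w c x l \<le> parab d N M w c x l'" if "l' \<in> std_simplex N" for l'
  proof -
    have "0 \<le> slack d N M w c x l l'" using * that by blast
    moreover have "0 \<le> M / 2 * (\<Sum>k<d. ((x $ k - x $ k) - (\<Sum>j<N. (l' j - l j) * w j k))\<^sup>2)"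
      using assms by (intro mult_nonneg_nonneg sum_nonneg) auto
    ultimately show ?thesis using parab_expand[of d N M w c x l' x l] by simp
  qed
  then show "parab_min d N M w c x l" using assms by (simp add: parab_min_def)
next
  assume m: "parab_min d N M w c x l"
  show "\<forall>l'\<in>std_simplex N. 0 \<le> slack d N M w c x l l'"
  proof (rule ballI, rule ccontr)
    fix l' assume l': "l' \<in> std_simplex N" and neg: "\<not> 0 \<le> slack d N M w c x l l'"
    define A B where "A = slack d N M w c x l l'"
      and "B = M / 2 * (\<Sum>k<d. (\<Sum>j<N. (l' j - l j) * w j k)\<^sup>2)"
    have A: "A < 0" using neg by (simp add: A_def)
    have B: "0 \<le> B" unfolding B_def using assms by (intro mult_nonneg_nonneg sum_nonneg) auto
    have quad: "0 \<le> t * A + t\<^sup>2 * B" if t: "0 \<le> t" "t \<le> 1" for t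
    proof -
      let ?l = "\<lambda>j. l j + t * (l' j - l j)"
      have sc: "(\<Sum>j<N. (?l j - l j) * u j) = t * (\<Sum>j<N. (l' j - l j) * u j)" for u :: "nat \<Rightarrow> real"
        by (simp add: sum_distrib_left mult.assoc)
      have "(\<Sum>k<d. r k * (t * s k)) = t * (\<Sum>k<d. r k * s k)" for r s :: "nat \<Rightarrow> real"
        by (simp add: sum_distrib_left mult.left_commute)
      then have "slack d N M w c x l ?l = t * A"
        unfolding slack_def A_def sc by (simp only: right_diff_distrib mult.left_commute)
      moreover have "M / 2 * (\<Sum>k<d. ((x $ k - x $ k) - (\<Sum>j<N. (?l j - l j) * w j k))\<^sup>2) = t\<^sup>2 * B"
        unfolding sc B_def by (simp add: power_mult_distrib mult.left_commute flip: sum_distrib_left)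
      moreover have "parab d N M w c x l \<le> parab d N M w c x ?l"
        using m std_simplex_segment[OF assms(2) l' t] by (simp add: parab_min_def)
      ultimately show ?thesis using parab_expand[of d N M w c x ?l x l] by simp
    qed
    \<comment> \<open>For \<open>A < 0\<close> the polynomial \<open>t * A + t^2 * B\<close> is
      negative for small positive \<open>t\<close>; \<open>B + 1\<close> replaces \<open>B\<close>
      because \<open>B\<close> may be 0.\<close>
    define t where "t = min 1 (- A / (2 * (B + 1)))"
    have "0 < - A / (2 * (B + 1))" using A B by (intro divide_pos_pos) auto
    then have t: "0 < t" "t \<le> 1" by (auto simp: t_def)
    have "t * (B + 1) \<le> - A / 2"
    proof -
      have "t * (B + 1) \<le> - A / (2 * (B + 1)) * (B + 1)"
        using B by (intro mult_right_mono) (auto simp: t_def)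
      also have "\<dots> = - A / 2" using B by (simp add: divide_simps)
      finally show ?thesis .
    qed
    then have "t * B < - A" using A t by (simp add: algebra_simps)
    then have "t * (A + t * B) < 0" using t by (intro mult_pos_neg) auto
    then show False using quad[of t] t by (simp add: power2_eq_square algebra_simps)
  qed
qed

text \<open>The slack is affine in \<open>l'\<close>, so its sign on the simplex is decided at the
  vertices. The assumption is its nonnegativity from vertex \<open>i\<close> towards each vertex
  \<open>j\<close>.\<close>

lemma slack_vertices:
  assumes i: "i < N" and l': "l' \<in> std_simplex N"
    and "\<And>j. j < N \<Longrightarrow> 0 \<le> c j - c i - M * (\<Sum>k<d. (x $ k - w i k) * (w j k - w i k))"
  shows "0 \<le> slack d N M w c x (\<lambda>j. if j = i then 1 else 0) l'"
proof -
  let ?e = "\<lambda>j. if j = i then 1 else 0 :: real"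
  have e: "(\<Sum>j<N. ?e j * g j) = g i" for g :: "nat \<Rightarrow> real" using i by (simp add: if_distrib[of "\<lambda>x. x * _"] cong: if_cong)
  have d: "(\<Sum>j<N. (l' j - ?e j) * g j) = (\<Sum>j<N. l' j * (g j - g i))" for g :: "nat \<Rightarrow> real"
  proof -
    have "(\<Sum>j<N. l' j * g i) = g i" using l' by (simp add: std_simplex_def flip: sum_distrib_right)
    then show ?thesis using e[of g] by (simp add: left_diff_distrib right_diff_distrib sum_subtractf)
  qed
  have "slack d N M w c x ?e l' = (\<Sum>j<N. l' j * (c j - c i))
      - M * (\<Sum>k<d. (x $ k - w i k) * (\<Sum>j<N. l' j * (w j k - w i k)))"
    unfolding slack_def d e ..
  also have "(\<Sum>k<d. (x $ k - w i k) * (\<Sum>j<N. l' j * (w j k - w i k)))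
     = (\<Sum>j<N. l' j * (\<Sum>k<d. (x $ k - w i k) * (w j k - w i k)))"
    unfolding sum_distrib_left by (subst sum.swap) (simp add: mult_ac)
  also have "(\<Sum>j<N. l' j * (c j - c i)) - M * (\<Sum>j<N. l' j * (\<Sum>k<d. (x $ k - w i k) * (w j k - w i k)))
     = (\<Sum>j<N. l' j * (c j - c i - M * (\<Sum>k<d. (x $ k - w i k) * (w j k - w i k))))"
    by (simp add: sum_distrib_left[of M "\<lambda>j. l' j * _ j"] right_diff_distrib sum_subtractf mult.left_commute)
  also have "0 \<le> \<dots>" using assms by (intro sum_nonneg mult_nonneg_nonneg) (auto simp: std_simplex_def)
  finally show ?thesis .
qed

text \<open>This turns optimality of a vertex into the interpolation inequality: \<open>u\<close>
  and \<open>v\<close> are the centers of the parabolas belonging to the data \<open>(a, p)\<close>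
  and \<open>(b, q)\<close>. Both sides equal \<open>q * D + (m * E^2 + \<mu> * D^2) / 2\<close> in
  the notation of the proof.\<close>

lemma smoothing_identity:
  fixes \<mu> L a b p q :: real
  assumes "0 < \<mu>" "\<mu> < L" "u = (L * a - p) / (L - \<mu>)" "v = (L * b - q) / (L - \<mu>)"
  shows "\<mu> / 2 * a\<^sup>2 + (L - \<mu>) / 2 * (a - u)\<^sup>2 - (\<mu> / 2 * b\<^sup>2 + (L - \<mu>) / 2 * (b - v)\<^sup>2)
      + (L - \<mu>) * ((b - v) * (u - v)) =
    q * (a - b) + 1 / (2 * L) * (p - q)\<^sup>2 + \<mu> / (2 * (1 - \<mu> / L)) * ((a - b) - 1 / L * (p - q))\<^sup>2"
proof -
  define m A B D E where "m = L - \<mu>" and "A = a - u" and "B = b - v" and "D = a - b" and "E = A - B"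
  have m: "m > 0" "m \<noteq> 0" "\<mu> = L - m" and L: "L > 0" using assms by (auto simp: m_def)
  have u: "m * u = L * a - p" and v: "m * v = L * b - q"
    using assms by (simp_all add: m_def)
  have q: "q = m * B + \<mu> * b" using v by (simp add: B_def m algebra_simps)
  have pq: "p - q = m * E + \<mu> * D" using u v by (simp add: A_def B_def D_def E_def m algebra_simps)
  have dl: "D - 1 / L * (m * E + \<mu> * D) = m * (D - E) / L"
    using L by (simp add: m field_simps)
  have C: "\<mu> / (2 * (1 - \<mu> / L)) = \<mu> * L / (2 * m)" using assms by (simp add: m_def field_simps)
  have "\<mu> * L / (2 * m) * (m * (D - E) / L)\<^sup>2 = \<mu> * m * (D - E)\<^sup>2 / (2 * L)"
    using m L by (simp add: field_simps power2_eq_square)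
  then have "1 / (2 * L) * (m * E + \<mu> * D)\<^sup>2 + \<mu> * L / (2 * m) * (m * (D - E) / L)\<^sup>2
     = ((m * E + \<mu> * D)\<^sup>2 + \<mu> * m * (D - E)\<^sup>2) / (2 * L)"
    by (simp add: add_divide_distrib)
  also have "(m * E + \<mu> * D)\<^sup>2 + \<mu> * m * (D - E)\<^sup>2 = L * (m * E\<^sup>2 + \<mu> * D\<^sup>2)"
    by (simp add: m power2_eq_square algebra_simps)
  also have "\<dots> / (2 * L) = (m * E\<^sup>2 + \<mu> * D\<^sup>2) / 2" using L by simp
  finally have *: "1 / (2 * L) * (p - q)\<^sup>2 + \<mu> / (2 * (1 - \<mu> / L)) * (D - 1 / L * (p - q))\<^sup>2
     = (m * E\<^sup>2 + \<mu> * D\<^sup>2) / 2"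
    unfolding pq dl C .
  have uv: "u - v = D - E" by (simp add: A_def B_def D_def E_def)
  have "A = B + E" "a = b + D" by (auto simp: E_def D_def)
  then have "\<mu> / 2 * a\<^sup>2 + m / 2 * A\<^sup>2 - (\<mu> / 2 * b\<^sup>2 + m / 2 * B\<^sup>2) + m * (B * (D - E))
      = q * D + (m * E\<^sup>2 + \<mu> * D\<^sup>2) / 2"
    unfolding q by (simp add: power2_eq_square field_simps)
  then show ?thesis
    using * unfolding m_def[symmetric] A_def[symmetric] B_def[symmetric] D_def[symmetric] uv by linarith
qed

text \<open>The interpolation inequalities say exactly that at \<open>x i\<close> the
  \<open>i\<close>-th parabola alone attains the minimum over the simplex, so value and gradient
  there are the prescribed ones.\<close>

lemma strongly_convex_interpolation:
  fixes x g :: "nat \<Rightarrow> real vec" and h :: "nat \<Rightarrow> real"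
  assumes \<mu>: "0 < \<mu>" "\<mu> < L" and N: "N > 0"
    and xc: "\<And>i. i < N \<Longrightarrow> x i \<in> carrier_vec d" and gc: "\<And>i. i < N \<Longrightarrow> g i \<in> carrier_vec d"
    and interp: "\<And>i j. i < N \<Longrightarrow> j < N \<Longrightarrow> h i - h j \<ge>
      (\<Sum>k<d. g j $ k * (x i $ k - x j $ k) + 1 / (2 * L) * (g i $ k - g j $ k)\<^sup>2
      + \<mu> / (2 * (1 - \<mu> / L)) * ((x i $ k - x j $ k) - 1 / L * (g i $ k - g j $ k))\<^sup>2)"
  shows "\<exists>f\<in>F_class d \<mu> L. \<forall>i<N. f (x i) = h i \<and> grad d f (x i) = g i"
proof -
  define M where "M = L - \<mu>"
  have M: "M > 0" using \<mu> by (simp add: M_def)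
  \<comment> \<open>The center solves \<open>\<mu> * x j + M * (x j - w j) = g j\<close>, so that
    \<open>\<mu> / 2 * |y|^2\<close> plus the \<open>j\<close>-th parabola has gradient
    \<open>g j\<close> at \<open>x j\<close>; the height \<open>c j\<close> then makes its value
    there equal to \<open>h j\<close>.\<close>
  define w where "w j k = (L * x j $ k - g j $ k) / M" for j k
  define c where "c j = h j - (\<Sum>k<d. \<mu> / 2 * (x j $ k)\<^sup>2 + M / 2 * (x j $ k - w j k)\<^sup>2)" for j
  define f where "f y = \<mu> / 2 * (\<Sum>k<d. (y $ k)\<^sup>2) + parab d N M w c y (SOME l. parab_min d N M w c y l)" for y
  \<comment> \<open>The gradient of \<open>f\<close> at \<open>y\<close> by the envelope principle:
    the minimizing weights \<open>l\<close> are frozen while \<open>y\<close> varies.\<close>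
  define G where "G y l = vec d (\<lambda>k. \<mu> * y $ k + M * (y $ k - (\<Sum>j<N. l j * w j k)))" for y l
  have f_eq: "f y = \<mu> / 2 * (\<Sum>k<d. (y $ k)\<^sup>2) + parab d N M w c y l"
    if "parab_min d N M w c y l" for y l
  proof -
    have "parab_min d N M w c y (SOME l. parab_min d N M w c y l)" using that by (rule someI[of "parab_min d N M w c y"])
    with that show ?thesis unfolding f_def parab_min_def by (simp add: order_antisym)
  qed
  have qb: "quad_bounds d \<mu> L f y (G y l)" if yc: "y \<in> carrier_vec d" and l: "parab_min d N M w c y l" for y l
    unfolding quad_bounds_def
  proof (intro conjI ballI)
    show "G y l \<in> carrier_vec d" by (simp add: G_def)
    fix z :: "real vec" assume zc: "z \<in> carrier_vec d"
    obtain l' where l': "parab_min d N M w c z l'" using parab_min_exists[OF N] by blast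
    let ?r = "\<lambda>k. y $ k - (\<Sum>j<N. l j * w j k)"
    have lin: "G y l \<bullet> (z - y) = \<mu> * (\<Sum>k<d. y $ k * (z $ k - y $ k)) + M * (\<Sum>k<d. ?r k * (z $ k - y $ k))"
      using yc zc by (simp add: scalar_prod_sum[of _ d] G_def distrib_right sum.distrib sum_distrib_left mult.assoc)
    have sq: "(vnorm (z - y))\<^sup>2 = (\<Sum>k<d. (z $ k - y $ k)\<^sup>2)"
      using yc zc by (simp add: vnorm_sq[of _ d])
    have sqz: "\<mu> / 2 * (\<Sum>k<d. (z $ k)\<^sup>2) = \<mu> / 2 * (\<Sum>k<d. (y $ k)\<^sup>2)
        + \<mu> * (\<Sum>k<d. y $ k * (z $ k - y $ k)) + \<mu> / 2 * (\<Sum>k<d. (z $ k - y $ k)\<^sup>2)"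
      unfolding sum_distrib_left sum.distrib[symmetric]
      by (intro sum.cong refl) (simp add: power2_eq_square algebra_simps)
    \<comment> \<open>Upper bound: the weights optimal at \<open>y\<close> are merely admissible at
      \<open>z\<close>.\<close>
    have "parab d N M w c z l = parab d N M w c y l
        + M * (\<Sum>k<d. ?r k * (z $ k - y $ k)) + M / 2 * (\<Sum>k<d. (z $ k - y $ k)\<^sup>2)"
      using parab_expand[of d N M w c z l y l] by (simp add: slack_def)
    moreover have "parab d N M w c z l' \<le> parab d N M w c z l"
      using l l' by (simp add: parab_min_def)
    moreover have "L / 2 * (\<Sum>k<d. (z $ k - y $ k)\<^sup>2)
       = \<mu> / 2 * (\<Sum>k<d. (z $ k - y $ k)\<^sup>2) + M / 2 * (\<Sum>k<d. (z $ k - y $ k)\<^sup>2)"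
      by (simp add: M_def field_simps)
    ultimately show "f z \<le> f y + G y l \<bullet> (z - y) + L / 2 * (vnorm (z - y))\<^sup>2"
      unfolding f_eq[OF l] f_eq[OF l'] lin sq sqz by linarith
    \<comment> \<open>Lower bound: expand around \<open>(y, l)\<close> towards the optimal pair
      \<open>(z, l')\<close> and discard two nonnegative terms.\<close>
    have "0 \<le> slack d N M w c y l l'"
      using l l' M parab_min_iff_slack[of M l N d w c y] by (auto simp: parab_min_def)
    moreover have "0 \<le> M / 2 * (\<Sum>k<d. ((z $ k - y $ k) - (\<Sum>j<N. (l' j - l j) * w j k))\<^sup>2)"
      using M by (intro mult_nonneg_nonneg sum_nonneg) auto
    ultimately show "f z \<ge> f y + G y l \<bullet> (z - y) + \<mu> / 2 * (vnorm (z - y))\<^sup>2"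
      using parab_expand[of d N M w c z l' y l]
      unfolding f_eq[OF l] f_eq[OF l'] lin sq sqz by linarith
  qed
  have "f \<in> F_class d \<mu> L"
    using \<mu> qb parab_min_exists[OF N] by (intro quad_bounds_F_class) (auto, blast)
  moreover have "f (x i) = h i \<and> grad d f (x i) = g i" if i: "i < N" for i
  proof -
    let ?e = "\<lambda>j. if j = i then 1 else 0 :: real"
    have e: "(\<Sum>j<N. ?e j * g j) = g i" for g :: "nat \<Rightarrow> real"
      using i by (simp add: if_distrib[of "\<lambda>x. x * _"] cong: if_cong)
    have min: "parab_min d N M w c (x i) ?e"
      unfolding parab_min_iff_slack[OF less_imp_le[OF M] std_simplex_vertex[OF i]]
    proof (intro ballI slack_vertices i)
      fix j assume j: "j < N"
      have "c j - c i - M * (\<Sum>k<d. (x i $ k - w i k) * (w j k - w i k)) = h j - h i -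
        (\<Sum>k<d. \<mu> / 2 * (x j $ k)\<^sup>2 + M / 2 * (x j $ k - w j k)\<^sup>2 - (\<mu> / 2 * (x i $ k)\<^sup>2 + M / 2 * (x i $ k - w i k)\<^sup>2)
          + M * ((x i $ k - w i k) * (w j k - w i k)))"
        by (simp add: c_def sum.distrib sum_subtractf sum_distrib_left)
      also have "\<dots> = h j - h i - (\<Sum>k<d. g i $ k * (x j $ k - x i $ k) + 1 / (2 * L) * (g j $ k - g i $ k)\<^sup>2
         + \<mu> / (2 * (1 - \<mu> / L)) * ((x j $ k - x i $ k) - 1 / L * (g j $ k - g i $ k))\<^sup>2)"
      proof (intro arg_cong2[of _ _ _ _ "(-)"] refl sum.cong)
        fix k assume "k \<in> {..<d}"
        show "\<mu> / 2 * (x j $ k)\<^sup>2 + M / 2 * (x j $ k - w j k)\<^sup>2 - (\<mu> / 2 * (x i $ k)\<^sup>2 + M / 2 * (x i $ k - w i k)\<^sup>2)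
            + M * ((x i $ k - w i k) * (w j k - w i k)) =
          g i $ k * (x j $ k - x i $ k) + 1 / (2 * L) * (g j $ k - g i $ k)\<^sup>2
            + \<mu> / (2 * (1 - \<mu> / L)) * ((x j $ k - x i $ k) - 1 / L * (g j $ k - g i $ k))\<^sup>2"
          using \<mu> unfolding w_def M_def by (intro smoothing_identity) auto
      qed
      also have "0 \<le> \<dots>" using interp[OF j i] by simp
      finally show "0 \<le> c j - c i - M * (\<Sum>k<d. (x i $ k - w i k) * (w j k - w i k))" .
    qed
    have "f (x i) = h i"
      unfolding f_eq[OF min] parab_def e by (simp add: c_def sum.distrib sum_distrib_left)
    moreover have "G (x i) ?e = g i"
    proof (rule eq_vecI)
      fix k assume "k < dim_vec (g i)"
      then have k: "k < d" using gc[OF i] by simp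
      show "G (x i) ?e $ k = g i $ k" using k M
        unfolding G_def index_vec[OF k] e by (simp add: w_def M_def field_simps)
    qed (use gc[OF i] in \<open>simp add: G_def\<close>)
    moreover have "has_gradient d f (x i) (G (x i) ?e)"
      using qb[OF xc[OF i] min] \<mu> by (intro quad_bounds_has_gradient) auto
    ultimately show ?thesis using grad_eq[OF xc[OF i]] by simp
  qed
  ultimately show ?thesis by blast
qed

subsection \<open>The quadratic forms of the heavy-ball cycle\<close>

text \<open>The heavy-ball step solved for the gradient, one coordinate at a time. Sequences are
  indexed by integers so that predecessors always exist; cyclicity is expressed by
  \<open>periodic\<close>.\<close>

definition hb_grad :: "real \<Rightarrow> real \<Rightarrow> (int \<Rightarrow> real) \<Rightarrow> int \<Rightarrow> real" where
  "hb_grad \<gamma> \<beta> X i = ((1 + \<beta>) * X i - X (i + 1) - \<beta> * X (i - 1)) / \<gamma>"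

text \<open>Polarization of the right-hand side of the interpolation inequality between the \<open>i\<close>-th and \<open>j\<close>-th points,
  for one coordinate of the points.\<close>

definition interp_form ::
    "real \<Rightarrow> real \<Rightarrow> real \<Rightarrow> real \<Rightarrow> int \<Rightarrow> int \<Rightarrow> (int \<Rightarrow> real) \<Rightarrow> (int \<Rightarrow> real) \<Rightarrow> real" where
  "interp_form \<mu> L \<gamma> \<beta> i j X Y =
     (let g = hb_grad \<gamma> \<beta> in
       1 / 2 * (g X j * (Y i - Y j) + (X i - X j) * g Y j)
       + 1 / (2 * L) * ((g X i - g X j) * (g Y i - g Y j))
       + \<mu> / (2 * (1 - \<mu> / L)) * (((X i - X j) - 1 / L * (g X i - g X j)) * ((Y i - Y j) - 1 / L * (g Y i - g Y j))))"

text \<open>The coordinate \<open>p\<close> of the cyclic basis vector with index \<open>m\<close>.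
  As sequences in \<open>m\<close>, these span the periodic sequences.\<close>

definition cyc_delta :: "nat \<Rightarrow> int \<Rightarrow> int \<Rightarrow> real" where
  "cyc_delta K p m = (if p mod int K = m mod int K then 1 else 0)"

definition periodic :: "nat \<Rightarrow> (int \<Rightarrow> 'a) \<Rightarrow> bool" where
  "periodic K X \<longleftrightarrow> (\<forall>m. X (m mod int K) = X m)"

lemma periodicD: "periodic K X \<Longrightarrow> X (m mod int K) = X m"
  by (simp add: periodic_def)

lemma periodic_cong: "periodic K X \<Longrightarrow> m mod int K = n mod int K \<Longrightarrow> X m = X n"
  by (metis periodicD)

lemma sum_periodic_shift:
  fixes f :: "int \<Rightarrow> 'a::comm_monoid_add"
  assumes "K > 0" "periodic K f"
  shows "(\<Sum>p<K. f (int p + s)) = (\<Sum>p<K. f (int p))"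
  by (rule sum.reindex_bij_witness[of _ "\<lambda>p. nat ((int p - s) mod int K)" "\<lambda>p. nat ((int p + s) mod int K)"])
     (use assms in \<open>auto simp: mod_simps nat_less_iff periodicD\<close>)

lemma sum_cyc_delta:
  assumes "K > 0" "periodic K X"
  shows "(\<Sum>p<K. X (int p) * cyc_delta K (int p) m) = X m"
proof -
  have "(\<Sum>p<K. X (int p) * cyc_delta K (int p) m) = (\<Sum>p<K. if p = nat (m mod int K) then X m else 0)"
    using assms by (intro sum.cong refl) (auto simp: cyc_delta_def periodicD nat_eq_iff)
  also have "\<dots> = X m" using assms by (simp add: nat_less_iff)
  finally show ?thesis .
qed

lemma periodic_cyc_delta: "periodic K (cyc_delta K p)"
  by (simp add: periodic_def cyc_delta_def)

lemma cyc_delta_shift: "cyc_delta K p (m + s) = cyc_delta K (p - s) m"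
  using mod_add_cong[of p "int K" "m + s" "- s" "- s"] mod_add_cong[of "p - s" "int K" "m" s s]
  by (auto simp: cyc_delta_def)

lemma hb_grad_shift: "hb_grad \<gamma> \<beta> X (i + s) = hb_grad \<gamma> \<beta> (\<lambda>m. X (m + s)) i"
  by (simp add: hb_grad_def algebra_simps)

lemma periodic_hb_grad:
  assumes "periodic K X" shows "periodic K (hb_grad \<gamma> \<beta> X)"
proof -
  have "X (m mod int K + s) = X (m + s)" for m s
    by (rule periodic_cong[OF assms]) (simp add: mod_simps)
  from this[of _ 0] this[of _ 1] this[of _ "-1"] show ?thesis
    by (simp add: periodic_def hb_grad_def)
qed

lemma hb_grad_sum: "hb_grad \<gamma> \<beta> (\<lambda>m. \<Sum>p\<in>A. u p * X p m) i = (\<Sum>p\<in>A. u p * hb_grad \<gamma> \<beta> (X p) i)"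
proof -
  have "(\<Sum>p\<in>A. u p * hb_grad \<gamma> \<beta> (X p) i) =
    (\<Sum>p\<in>A. ((1 + \<beta>) * (u p * X p i) - u p * X p (i + 1) - \<beta> * (u p * X p (i - 1))) / \<gamma>)"
    by (intro sum.cong refl) (simp add: hb_grad_def algebra_simps)
  also have "\<dots> = hb_grad \<gamma> \<beta> (\<lambda>m. \<Sum>p\<in>A. u p * X p m) i"
    by (simp add: hb_grad_def sum_divide_distrib[symmetric] sum_subtractf sum_distrib_left)
  finally show ?thesis by simp
qed

lemma interp_form_sym: "interp_form \<mu> L \<gamma> \<beta> i j X Y = interp_form \<mu> L \<gamma> \<beta> i j Y X"
  by (simp add: interp_form_def Let_def algebra_simps)

lemma interp_form_shift:
  "interp_form \<mu> L \<gamma> \<beta> (i + s) (j + s) X Y = interp_form \<mu> L \<gamma> \<beta> i j (\<lambda>m. X (m + s)) (\<lambda>m. Y (m + s))"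
  by (simp add: interp_form_def Let_def hb_grad_shift)

lemma interp_form_mod:
  assumes "periodic K X" "periodic K Y"
  shows "interp_form \<mu> L \<gamma> \<beta> (i mod int K) (j mod int K) X Y = interp_form \<mu> L \<gamma> \<beta> i j X Y"
  using assms[THEN periodicD] assms[THEN periodic_hb_grad, THEN periodicD]
  by (simp add: interp_form_def Let_def)

lemma interp_form_sum_left:
  "interp_form \<mu> L \<gamma> \<beta> i j (\<lambda>m. \<Sum>p\<in>A. u p * X p m) Y = (\<Sum>p\<in>A. u p * interp_form \<mu> L \<gamma> \<beta> i j (X p) Y)"
proof -
  \<comment> \<open>With \<open>Y\<close> fixed, the form is a linear functional of four numbers
    attached to \<open>Z\<close>, with coefficients that do not depend on \<open>Z\<close>.\<close>
  obtain a b c d where *: "interp_form \<mu> L \<gamma> \<beta> i j Z Y =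
      a * Z i + b * Z j + c * hb_grad \<gamma> \<beta> Z i + d * hb_grad \<gamma> \<beta> Z j" for Z
  proof
    fix Z
    let ?g = "hb_grad \<gamma> \<beta>" and ?C = "\<mu> / (2 * (1 - \<mu> / L))"
    let ?P = "?C * ((Y i - Y j) - 1 / L * (?g Y i - ?g Y j))"
    show "interp_form \<mu> L \<gamma> \<beta> i j Z Y = (1 / 2 * ?g Y j + ?P) * Z i + (- (1 / 2 * ?g Y j) - ?P) * Z j
      + (1 / (2 * L) * (?g Y i - ?g Y j) - 1 / L * ?P) * ?g Z i
      + (1 / 2 * (Y i - Y j) - (1 / (2 * L) * (?g Y i - ?g Y j) - 1 / L * ?P)) * ?g Z j"
      by (simp only: interp_form_def Let_def ring_distribs mult_1 mult_ac diff_conv_add_uminus minus_add_distrib minus_minus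
        mult_minus_left mult_minus_right add_ac)
  qed
  have "(\<Sum>p\<in>A. u p * (a * X p i + b * X p j + c * hb_grad \<gamma> \<beta> (X p) i + d * hb_grad \<gamma> \<beta> (X p) j)) =
    (\<Sum>p\<in>A. a * (u p * X p i) + b * (u p * X p j) + c * (u p * hb_grad \<gamma> \<beta> (X p) i)
      + d * (u p * hb_grad \<gamma> \<beta> (X p) j))"
    by (intro sum.cong refl) (simp add: algebra_simps)
  then show ?thesis by (simp add: * hb_grad_sum sum.distrib sum_distrib_left)
qed

lemma interp_form_sum_right:
  "interp_form \<mu> L \<gamma> \<beta> i j Y (\<lambda>m. \<Sum>p\<in>A. u p * X p m) = (\<Sum>p\<in>A. u p * interp_form \<mu> L \<gamma> \<beta> i j Y (X p))"
  unfolding interp_form_sym[of _ _ _ _ _ _ Y] by (rule interp_form_sum_left)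

text \<open>The entries of \<open>M_mat\<close>, extended periodically to integer indices so that
  all four indices can be shifted together.\<close>

definition cyc_form :: "nat \<Rightarrow> real \<Rightarrow> real \<Rightarrow> real \<Rightarrow> real \<Rightarrow> int \<Rightarrow> int \<Rightarrow> int \<Rightarrow> int \<Rightarrow> real" where
  "cyc_form K \<mu> L \<gamma> \<beta> i j p q = interp_form \<mu> L \<gamma> \<beta> i j (cyc_delta K p) (cyc_delta K q)"

lemma cyc_form_shift: "cyc_form K \<mu> L \<gamma> \<beta> (i + s) (j + s) (p + s) (q + s) = cyc_form K \<mu> L \<gamma> \<beta> i j p q"
  by (simp add: cyc_form_def interp_form_shift cyc_delta_shift)

lemma cyc_form_mod: "cyc_form K \<mu> L \<gamma> \<beta> (i mod int K) (j mod int K) p q = cyc_form K \<mu> L \<gamma> \<beta> i j p q"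
  by (simp add: cyc_form_def interp_form_mod periodic_cyc_delta)

lemma periodic_cyc_form:
  "periodic K (\<lambda>p. cyc_form K \<mu> L \<gamma> \<beta> i j p q)" "periodic K (cyc_form K \<mu> L \<gamma> \<beta> i j p)"
proof -
  have "cyc_delta K (p mod int K) = cyc_delta K p" for p by (auto simp: cyc_delta_def)
  then show "periodic K (\<lambda>p. cyc_form K \<mu> L \<gamma> \<beta> i j p q)" "periodic K (cyc_form K \<mu> L \<gamma> \<beta> i j p)"
    by (simp_all add: periodic_def cyc_form_def)
qed

lemma interp_form_expand:
  assumes "K > 0" "periodic K X"
  shows "interp_form \<mu> L \<gamma> \<beta> i j X X
    = (\<Sum>p<K. \<Sum>q<K. X (int p) * X (int q) * cyc_form K \<mu> L \<gamma> \<beta> i j (int p) (int q))"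
proof -
  have X: "X = (\<lambda>m. \<Sum>p<K. X (int p) * cyc_delta K (int p) m)" using sum_cyc_delta[OF assms] by auto
  have "interp_form \<mu> L \<gamma> \<beta> i j X X =
    interp_form \<mu> L \<gamma> \<beta> i j (\<lambda>m. \<Sum>p<K. X (int p) * cyc_delta K (int p) m) (\<lambda>m. \<Sum>p<K. X (int p) * cyc_delta K (int p) m)"
    using X by simp
  also have "\<dots> = (\<Sum>p<K. \<Sum>q<K. X (int p) * X (int q) * cyc_form K \<mu> L \<gamma> \<beta> i j (int p) (int q))"
    unfolding interp_form_sum_left interp_form_sum_right cyc_form_def
    by (simp add: sum_distrib_left mult.assoc)
  finally show ?thesis .
qed

text \<open>A common shift of the two points is moved onto the weights: reindex both cyclic sums by
  \<open>s\<close>, then apply \<open>cyc_form_shift\<close>.\<close>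

lemma sum_cyc_form_shift:
  assumes "K > 0" and per: "\<And>q. periodic K (\<lambda>p. W p q)" "\<And>p. periodic K (W p)"
  shows "(\<Sum>p<K. \<Sum>q<K. W (int p) (int q) * cyc_form K \<mu> L \<gamma> \<beta> (i + s) (j + s) (int p) (int q))
    = (\<Sum>p<K. \<Sum>q<K. W (int p + s) (int q + s) * cyc_form K \<mu> L \<gamma> \<beta> i j (int p) (int q))"
proof -
  let ?c = "cyc_form K \<mu> L \<gamma> \<beta> (i + s) (j + s)"
  have pW: "W (m mod int K) n = W m n" "W n (m mod int K) = W n m" for m n
    using per[THEN periodicD] by auto
  have pc: "?c (m mod int K) n = ?c m n" "?c n (m mod int K) = ?c n m" for m n
    using periodic_cyc_form[THEN periodicD] by auto
  have "(\<Sum>p<K. \<Sum>q<K. W (int p) (int q) * ?c (int p) (int q))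
     = (\<Sum>p<K. \<Sum>q<K. W (int p) (int q + s) * ?c (int p) (int q + s))"
    by (intro sum.cong refl sum_periodic_shift[symmetric] assms(1)) (simp add: periodic_def pW pc)
  also have "\<dots> = (\<Sum>p<K. \<Sum>q<K. W (int p + s) (int q + s) * ?c (int p + s) (int q + s))"
    by (intro sum_periodic_shift[symmetric] assms(1)) (simp add: periodic_def pW pc)
  finally show ?thesis by (simp add: cyc_form_shift)
qed

section \<open>Entries of the matrices \<open>M_mat\<close> and their inner products\<close>

lemma index_e_cyc: "K > 0 \<Longrightarrow> p < K \<Longrightarrow> e_cyc K m $ p = cyc_delta K (int p) m"
  by (auto simp: e_cyc_def cyc_delta_def nat_eq_iff nat_less_iff)

lemma dim_e_cyc: "dim_vec (e_cyc K m) = K"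
  by (simp add: e_cyc_def)

lemma dim_a_vec: "dim_vec (a_vec K \<gamma> \<beta> m) = K"
  by (simp add: a_vec_def dim_e_cyc)

lemma index_a_vec: "K > 0 \<Longrightarrow> p < K \<Longrightarrow> a_vec K \<gamma> \<beta> m $ p = hb_grad \<gamma> \<beta> (cyc_delta K (int p)) m"
  by (simp add: a_vec_def hb_grad_def index_e_cyc dim_e_cyc)

lemma M_mat_carrier: "M_mat K \<mu> L \<gamma> \<beta> i j \<in> carrier_mat K K"
  by (simp add: M_mat_def Let_def outer_def b_vec_def dim_e_cyc dim_a_vec)

lemma index_M_mat:
  assumes "K > 0" "p < K" "q < K"
  shows "M_mat K \<mu> L \<gamma> \<beta> i j $$ (p, q) = cyc_form K \<mu> L \<gamma> \<beta> (int i) (int j) (int p) (int q)"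
  using assms by (simp add: M_mat_def Let_def outer_def b_vec_def dim_e_cyc dim_a_vec index_e_cyc index_a_vec
      cyc_form_def interp_form_def)

lemma mat_inner_sum:
  assumes "A \<in> carrier_mat K K" "B \<in> carrier_mat K K"
  shows "mat_inner A B = (\<Sum>p<K. \<Sum>q<K. A $$ (p, q) * B $$ (p, q))"
proof -
  have "mat_inner A B = (\<Sum>q<K. \<Sum>p<K. A $$ (p, q) * B $$ (p, q))"
    using assms by (auto simp: mat_inner_def mat_trace_def scalar_prod_def atLeast0LessThan)
  also have "\<dots> = (\<Sum>p<K. \<Sum>q<K. A $$ (p, q) * B $$ (p, q))" by (rule sum.swap)
  finally show ?thesis .
qed

lemma mat_inner_comm:
  assumes "A \<in> carrier_mat K K" "B \<in> carrier_mat K K"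
  shows "mat_inner A B = mat_inner B A"
  using assms by (simp add: mat_inner_sum mult.commute)

lemma mat_inner_M_mat:
  assumes "K > 0" "A \<in> carrier_mat K K"
  shows "mat_inner A (M_mat K \<mu> L \<gamma> \<beta> i j)
    = (\<Sum>p<K. \<Sum>q<K. A $$ (p, q) * cyc_form K \<mu> L \<gamma> \<beta> (int i) (int j) (int p) (int q))"
  using assms by (simp add: mat_inner_sum[OF _ M_mat_carrier] index_M_mat)

text \<open>A Gram matrix is a sum of rank-one matrices, one per coordinate, and each of them pairs
  with \<open>M_mat\<close> to a value of the quadratic form.\<close>

lemma mat_inner_Gram:
  assumes "K > 0" and "\<And>k. k < d \<Longrightarrow> periodic K (X k)" and "A \<in> carrier_mat K K"
    and "\<And>p q. p < K \<Longrightarrow> q < K \<Longrightarrow> A $$ (p, q) = (\<Sum>k<d. X k (int p) * X k (int q))"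
  shows "mat_inner A (M_mat K \<mu> L \<gamma> \<beta> i j) = (\<Sum>k<d. interp_form \<mu> L \<gamma> \<beta> (int i) (int j) (X k) (X k))"
proof -
  let ?c = "\<lambda>p q. cyc_form K \<mu> L \<gamma> \<beta> (int i) (int j) (int p) (int q)"
  have "mat_inner A (M_mat K \<mu> L \<gamma> \<beta> i j) = (\<Sum>p<K. \<Sum>q<K. \<Sum>k<d. X k (int p) * X k (int q) * ?c p q)"
    using assms(4) by (simp add: mat_inner_M_mat[OF assms(1,3)] sum_distrib_right)
  also have "\<dots> = (\<Sum>k<d. \<Sum>p<K. \<Sum>q<K. X k (int p) * X k (int q) * ?c p q)"
    by (subst sum.swap[of _ "{..<d}"]) (subst sum.swap[of _ "{..<d}"], rule refl)
  finally show ?thesis using assms by (simp add: interp_form_expand)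
qed

subsection \<open>Cosine decomposition of circulant matrices\<close>

definition dcos :: "nat \<Rightarrow> nat \<Rightarrow> int \<Rightarrow> real" where
  "dcos K l m = cos (2 * pi * real l / real K * of_int m)"

definition dsin :: "nat \<Rightarrow> nat \<Rightarrow> int \<Rightarrow> real" where
  "dsin K l m = sin (2 * pi * real l / real K * of_int m)"

lemma dcos_diff: "dcos K l (p - q) = dcos K l p * dcos K l q + dsin K l p * dsin K l q"
  by (simp add: dcos_def dsin_def right_diff_distrib cos_diff)

lemma dcos_add: "dcos K l (p + q) = dcos K l p * dcos K l q - dsin K l p * dsin K l q"
  by (simp add: dcos_def dsin_def distrib_left cos_add)

lemma angle_mod:
  assumes "K > 0"
  shows "2 * pi * real l / real K * of_int m
    = 2 * pi * real l / real K * of_int (m mod int K) + 2 * pi * of_int (int l * (m div int K))"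
proof -
  have "real_of_int m = of_int (m mod int K) + real K * of_int (m div int K)"
    by (metis mod_mult_div_eq of_int_add of_int_mult of_int_of_nat_eq)
  then show ?thesis using assms by (simp add: field_simps)
qed

lemma periodic_dcos:
  assumes "K > 0" shows "periodic K (dcos K l)"
proof -
  have "dcos K l m = dcos K l (m mod int K)" for m
    unfolding dcos_def angle_mod[OF assms, of l m] cos_add cos_int_2pin sin_int_2pin by simp
  then show ?thesis unfolding periodic_def by metis
qed

lemma periodic_dsin:
  assumes "K > 0" shows "periodic K (dsin K l)"
proof -
  have "dsin K l m = dsin K l (m mod int K)" for m
    unfolding dsin_def angle_mod[OF assms, of l m] sin_add cos_int_2pin sin_int_2pin by simp
  then show ?thesis unfolding periodic_def by metis
qed

text \<open>Frequencies \<open>l\<close> and \<open>K - l\<close> have the same cosines, which is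
  why those up to \<open>K div 2\<close> suffice.\<close>

lemma dcos_reflect:
  assumes "K > 0" "l \<le> K" shows "dcos K (K - l) m = dcos K l m"
proof -
  have "2 * pi * real (K - l) / real K * of_int m = 2 * pi * of_int m - 2 * pi * real l / real K * of_int m"
    using assms by (simp add: of_nat_diff field_simps)
  then show ?thesis by (simp add: dcos_def cos_diff)
qed

lemma dcos_ne_1:
  assumes "0 < l" "l < K" shows "dcos K l 1 \<noteq> 1"
proof
  assume "dcos K l 1 = 1"
  then obtain n :: int where "2 * pi * real l / real K = of_int n * 2 * pi"
    by (auto simp: dcos_def cos_one_2pi_int)
  then have "real l = of_int n * real K" using assms by (simp add: field_simps)
  then have "int l = n * int K" by (metis of_int_eq_iff of_int_mult of_int_of_nat_eq)
  then have "int K dvd int l" by simp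
  then show False using assms by (simp add: nat_dvd_not_less)
qed

lemma sum_dcos:
  assumes K: "K > 0"
  shows "(\<Sum>l<K. dcos K l m) = (if int K dvd m then real K else 0)"
proof (cases "int K dvd m")
  case True
  then obtain n where "m = int K * n" by blast
  then have "dcos K l m = cos (2 * pi * of_int (int l * n))" for l
    using K by (simp add: dcos_def mult_ac)
  then have "dcos K l m = 1" for l
    unfolding cos_int_2pin .
  then show ?thesis using True by simp
next
  case False
  define t where "t = 2 * pi * of_int m / real K"
  \<comment> \<open>The factor \<open>2 * sin (t / 2)\<close> makes the cosine sum telescope, as for
    the Dirichlet kernel.\<close>
  have "2 * sin (t / 2) * (\<Sum>l<n. cos (real l * t)) = sin ((real n - 1 / 2) * t) + sin (t / 2)" for n
  proof (induction n)
    case 0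
    then show ?case by simp
  next
    case (Suc n)
    have "sin ((real (Suc n) - 1 / 2) * t) - sin ((real n - 1 / 2) * t) = 2 * sin (t / 2) * cos (real n * t)"
      using sin_add[of "real n * t" "t / 2"] sin_diff[of "real n * t" "t / 2"]
      by (simp add: algebra_simps add_divide_distrib)
    then show ?case using Suc by (simp add: algebra_simps)
  qed
  moreover have "(real K - 1 / 2) * t = 2 * pi * of_int m - t / 2"
    using K by (simp add: t_def field_simps)
  ultimately have "2 * sin (t / 2) * (\<Sum>l<K. cos (real l * t)) = sin (2 * pi * of_int m - t / 2) + sin (t / 2)"
    by metis
  also have "\<dots> = 0" by (simp add: sin_diff)
  finally have "sin (t / 2) = 0 \<or> (\<Sum>l<K. cos (real l * t)) = 0" by simp
  \<comment> \<open>Here \<open>t / 2 = pi * m / K\<close>, so a vanishing sine would force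
    \<open>K\<close> to divide \<open>m\<close>.\<close>
  moreover have "sin (t / 2) \<noteq> 0"
  proof
    assume "sin (t / 2) = 0"
    then obtain n :: int where "t / 2 = of_int n * pi" by (auto simp: sin_zero_iff_int2)
    then have "real_of_int m = of_int n * real K" using K by (simp add: t_def field_simps)
    then have "m = n * int K" by (metis of_int_eq_iff of_int_mult of_int_of_nat_eq)
    with False show False by simp
  qed
  ultimately show ?thesis using False by (simp add: dcos_def t_def mult_ac)
qed

text \<open>Product-to-sum and orthogonality return the average of \<open>f k\<close> and
  \<open>f (- k)\<close>; evenness of \<open>f\<close> merges the two.\<close>

lemma dcos_inversion:
  assumes K: "K > 0" and f: "periodic K f" "\<And>m. f (- m) = f m"
  shows "(\<Sum>l<K. (\<Sum>m<K. f (int m) * dcos K l (int m)) * dcos K l k) = real K * f k"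
proof -
  have ev: "(\<Sum>m<K. f (int m) * (if int K dvd int m - n then real K else 0)) = real K * f n" for n
  proof -
    have "(\<Sum>m<K. f (int m) * (if int K dvd int m - n then real K else 0))
       = (\<Sum>m<K. real K * f (int m) * cyc_delta K (int m) n)"
      unfolding cyc_delta_def mod_eq_dvd_iff by (intro sum.cong refl) simp
    also have "\<dots> = real K * (\<Sum>m<K. f (int m) * cyc_delta K (int m) n)"
      by (simp add: sum_distrib_left mult.assoc)
    finally show ?thesis using sum_cyc_delta[OF K f(1)] by simp
  qed
  have pw: "dcos K l m * dcos K l k = 1 / 2 * (dcos K l (m - k) + dcos K l (m - (- k)))" for l m
    by (simp add: dcos_diff dcos_add)
  have "(\<Sum>l<K. (\<Sum>m<K. f (int m) * dcos K l (int m)) * dcos K l k)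
     = (\<Sum>m<K. \<Sum>l<K. f (int m) * (dcos K l (int m) * dcos K l k))"
    by (subst sum.swap) (simp add: sum_distrib_right mult.assoc)
  also have "\<dots> = (\<Sum>m<K. \<Sum>l<K. f (int m) * (1 / 2 * (dcos K l (int m - k) + dcos K l (int m - (- k)))))"
    by (simp only: pw)
  also have "\<dots> = (\<Sum>m<K. 1 / 2 * (f (int m) * (\<Sum>l<K. dcos K l (int m - k))
      + f (int m) * (\<Sum>l<K. dcos K l (int m - (- k)))))"
    by (simp only: sum_distrib_left sum.distrib distrib_left mult.left_commute)
  also have "\<dots> = 1 / 2 * (real K * f k + real K * f (- k))"
    unfolding sum_dcos[OF K] by (simp only: sum_distrib_left[symmetric] sum.distrib ev)
  finally show ?thesis by (simp add: f)
qed

text \<open>Pair \<open>l\<close> with \<open>K - l\<close>. For even \<open>K\<close> the index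
  \<open>K div 2\<close> is its own partner and is counted once.\<close>

lemma sum_fold_symmetric:
  fixes w :: "nat \<Rightarrow> real"
  assumes "\<And>l. 0 < l \<Longrightarrow> l < K \<Longrightarrow> w (K - l) = w l"
  shows "(\<Sum>l\<in>{1..<K}. w l) = (\<Sum>l=1..K div 2. (if 2 * l = K then 1 else 2) * w l)"
proof -
  have "(\<Sum>l\<in>{1..<K}. w l) = (\<Sum>l=1..K div 2. w l) + (\<Sum>l\<in>{K div 2 + 1..<K}. w l)" if "K > 1"
  proof -
    have "{1..<K} = {1..K div 2} \<union> {K div 2 + 1..<K}" using that by auto
    then show ?thesis by (simp only:) (rule sum.union_disjoint, auto)
  qed
  moreover have "(\<Sum>l\<in>{K div 2 + 1..<K}. w l) = (\<Sum>l\<in>{l\<in>{1..K div 2}. 2 * l \<noteq> K}. w l)"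
    by (rule sum.reindex_bij_witness[of _ "\<lambda>l. K - l" "\<lambda>l. K - l"]) (auto simp: assms)
  moreover have "\<dots> = (\<Sum>l=1..K div 2. if 2 * l \<noteq> K then w l else 0)"
    by (subst sum.inter_filter) auto
  moreover have "(\<Sum>l=1..K div 2. w l) + (\<Sum>l=1..K div 2. if 2 * l \<noteq> K then w l else 0)
    = (\<Sum>l=1..K div 2. (if 2 * l = K then 1 else 2) * w l)"
    by (subst sum.distrib[symmetric]) (rule sum.cong, auto)
  ultimately show ?thesis by (cases "K > 1") auto
qed

section \<open>Elementary facts on positive semidefinite matrices\<close>

lemma quadratic_form_sum:
  fixes G :: "real mat"
  assumes "G \<in> carrier_mat K K" "v \<in> carrier_vec K"
  shows "v \<bullet> (G *\<^sub>v v) = (\<Sum>p<K. \<Sum>q<K. v $ p * v $ q * G $$ (p, q))"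
proof -
  have "v \<bullet> (G *\<^sub>v v) = (\<Sum>p<K. v $ p * (\<Sum>q<K. G $$ (p, q) * v $ q))"
    using assms by (simp add: scalar_prod_def atLeast0LessThan)
  also have "\<dots> = (\<Sum>p<K. \<Sum>q<K. v $ p * v $ q * G $$ (p, q))"
    unfolding sum_distrib_left by (intro sum.cong refl) simp
  finally show ?thesis .
qed

lemma sym_psd_form:
  assumes "sym_psd K G"
  shows "0 \<le> (\<Sum>p<K. \<Sum>q<K. u p * u q * G $$ (p, q))"
proof -
  have "0 \<le> vec K u \<bullet> (G *\<^sub>v vec K u)" "G \<in> carrier_mat K K" using assms by (auto simp: sym_psd_def)
  then show ?thesis by (simp add: quadratic_form_sum)
qed

lemma sym_psd_sym: "sym_psd K G \<Longrightarrow> p < K \<Longrightarrow> q < K \<Longrightarrow> G $$ (p, q) = G $$ (q, p)"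
  unfolding sym_psd_def by (metis carrier_matD(1) carrier_matD(2) index_transpose_mat(1))

text \<open>The form at the test vector with 1 at position \<open>i\<close> plus \<open>t\<close> at
  position \<open>j\<close>; the case \<open>i = j\<close> is included.\<close>

lemma sym_psd_two:
  assumes "sym_psd K G" "i < K" "j < K"
  shows "0 \<le> G $$ (i, i) + 2 * t * G $$ (i, j) + t\<^sup>2 * G $$ (j, j)"
proof -
  define u where "u p = (if p = i then 1 else 0) + (if p = j then t else 0)" for p
  have su: "(\<Sum>q<K. u q * h q) = h i + t * h j" for h :: "nat \<Rightarrow> real"
    using assms by (simp add: u_def distrib_right sum.distrib if_distrib[of "\<lambda>x. x * _"] cong: if_cong)
  have "(\<Sum>p<K. \<Sum>q<K. u p * u q * G $$ (p, q)) = (\<Sum>p<K. u p * (\<Sum>q<K. u q * G $$ (p, q)))"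
    by (simp add: sum_distrib_left mult.assoc)
  also have "\<dots> = G $$ (i, i) + t * G $$ (i, j) + t * (G $$ (j, i) + t * G $$ (j, j))"
    by (simp add: su)
  finally show ?thesis using sym_psd_form[OF assms(1), of u] sym_psd_sym[OF assms(1,2,3)]
    by (simp add: power2_eq_square algebra_simps)
qed

lemma sym_psd_diag: "sym_psd K G \<Longrightarrow> i < K \<Longrightarrow> 0 \<le> G $$ (i, i)"
  using sym_psd_two[of K G i i 0] by simp

lemma sym_psd_trace_0:
  assumes G: "sym_psd K G" and tr: "(\<Sum>i<K. G $$ (i, i)) = 0"
  shows "G = 0\<^sub>m K K"
proof (rule eq_matI)
  have d: "G $$ (i, i) = 0" if "i < K" for i
  proof -
    have "\<forall>i\<in>{..<K}. G $$ (i, i) = 0"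
      using tr by (subst (asm) sum_nonneg_eq_0_iff) (auto intro: sym_psd_diag[OF G])
    then show ?thesis using that by simp
  qed
  fix i j assume "i < dim_row (0\<^sub>m K K :: real mat)" "j < dim_col (0\<^sub>m K K :: real mat)"
  then have ij: "i < K" "j < K" by auto
  then show "G $$ (i, j) = 0\<^sub>m K K $$ (i, j)"
  proof (cases "i = j")
    case False
    from sym_psd_two[OF G ij, of 1] sym_psd_two[OF G ij, of "-1"] show ?thesis
      using ij d by simp
  qed (use d in simp)
qed (use G in \<open>auto simp: sym_psd_def\<close>)

section \<open>Averaging a matrix over cyclic shifts\<close>

definition per_mat :: "nat \<Rightarrow> real mat \<Rightarrow> int \<Rightarrow> int \<Rightarrow> real" where
  "per_mat K G p q = G $$ (nat (p mod int K), nat (q mod int K))"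

lemma per_mat_nat: "p < K \<Longrightarrow> q < K \<Longrightarrow> per_mat K G (int p) (int q) = G $$ (p, q)"
  by (simp add: per_mat_def flip: of_nat_mod)

lemma periodic_per_mat: "periodic K (\<lambda>p. per_mat K G p q)" "periodic K (per_mat K G p)"
  by (simp_all add: periodic_def per_mat_def)

text \<open>The shift average of \<open>G\<close>, up to the factor \<open>K\<close>.\<close>

definition autocorr :: "nat \<Rightarrow> real mat \<Rightarrow> int \<Rightarrow> real" where
  "autocorr K G k = (\<Sum>s<K. per_mat K G (int s + k) (int s))"

lemma periodic_per_mat_shift: "periodic K (\<lambda>s. per_mat K G (s + p) (s + q))"
  by (simp add: periodic_def per_mat_def mod_simps)

lemma autocorr_diff:
  assumes "K > 0" shows "(\<Sum>s<K. per_mat K G (p + int s) (q + int s)) = autocorr K G (p - q)"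
proof -
  have "autocorr K G (p - q) = (\<Sum>s<K. per_mat K G (int s + q + (p - q)) (int s + q + 0))"
    unfolding autocorr_def
    using sum_periodic_shift[OF assms periodic_per_mat_shift[of K G "p - q" 0], of q] by simp
  then show ?thesis by (simp add: add.commute)
qed

lemma periodic_autocorr: "periodic K (autocorr K G)"
  by (simp add: periodic_def autocorr_def per_mat_def mod_simps)

lemma autocorr_even:
  assumes "K > 0" "sym_psd K G" shows "autocorr K G (- k) = autocorr K G k"
proof -
  have "per_mat K G p q = per_mat K G q p" for p q
    unfolding per_mat_def using assms by (intro sym_psd_sym) (auto simp: nat_less_iff)
  then show ?thesis using autocorr_diff[OF assms(1), of G 0 k] autocorr_diff[OF assms(1), of G k 0] by simp
qed

text \<open>By the addition formula the transform is the quadratic form of \<open>G\<close> at the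
  cosine vector plus that at the sine vector, hence nonnegative when \<open>G\<close> is positive
  semidefinite.\<close>

lemma autocorr_dcos:
  assumes K: "K > 0"
  shows "(\<Sum>m<K. autocorr K G (int m) * dcos K l (int m))
    = (\<Sum>p<K. \<Sum>q<K. dcos K l (int p) * dcos K l (int q) * G $$ (p, q))
    + (\<Sum>p<K. \<Sum>q<K. dsin K l (int p) * dsin K l (int q) * G $$ (p, q))"
proof -
  have sh: "(\<Sum>m<K. per_mat K G (int s + int m) (int s) * dcos K l (int m))
    = (\<Sum>p<K. per_mat K G (int p) (int s) * dcos K l (int p - int s))" for s
  proof -
    have "periodic K (\<lambda>m. per_mat K G m (int s) * dcos K l (m - int s))"
      unfolding periodic_def
      using periodicD[OF periodic_per_mat(1)[of K G]] periodic_cong[OF periodic_dcos[OF K, of l], of "_ mod int K - int s" "_ - int s"]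
      by (simp add: mod_simps)
    from sum_periodic_shift[OF K this, of "int s"] show ?thesis by (simp add: add.commute)
  qed
  have "(\<Sum>m<K. autocorr K G (int m) * dcos K l (int m))
     = (\<Sum>s<K. \<Sum>m<K. per_mat K G (int s + int m) (int s) * dcos K l (int m))"
    unfolding autocorr_def sum_distrib_right by (rule sum.swap)
  also have "\<dots> = (\<Sum>s<K. \<Sum>p<K. G $$ (p, s) * (dcos K l (int p) * dcos K l (int s) + dsin K l (int p) * dsin K l (int s)))"
    by (simp add: sh per_mat_nat dcos_diff)
  also have "\<dots> = (\<Sum>p<K. \<Sum>s<K. G $$ (p, s) * (dcos K l (int p) * dcos K l (int s) + dsin K l (int p) * dsin K l (int s)))"
    by (rule sum.swap)
  finally show ?thesis by (simp add: distrib_left sum.distrib mult_ac)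
qed

lemma autocorr_cosine_decomposition:
  assumes K: "K > 0" and G: "sym_psd K G" "G \<noteq> 0\<^sub>m K K" "G *\<^sub>v ones_vec K = 0\<^sub>v K"
  shows "\<exists>\<nu>. (\<forall>l. 0 \<le> \<nu> l) \<and> (\<exists>l\<in>{1..K div 2}. \<nu> l \<noteq> 0) \<and>
    (\<forall>k. autocorr K G k = (\<Sum>l=1..K div 2. \<nu> l * dcos K l k))"
proof -
  define h where "h l = (\<Sum>m<K. autocorr K G (int m) * dcos K l (int m))" for l
  \<comment> \<open>\<open>1 / K\<close> comes from the inversion formula, the factor 2 from folding
    frequency \<open>K - l\<close> onto \<open>l\<close>.\<close>
  define \<nu> where "\<nu> l = (if 2 * l = K then 1 else 2) * h l / real K" for l
  have h_nonneg: "0 \<le> h l" for l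
    unfolding h_def autocorr_dcos[OF K] by (intro add_nonneg_nonneg sym_psd_form G)
  \<comment> \<open>At frequency 0 the cosines are 1 and the sines 0, so \<open>h 0\<close> is the
    sum of all entries of \<open>G\<close>, whose rows sum to zero.\<close>
  have h0: "h 0 = 0"
  proof -
    have Gc: "G \<in> carrier_mat K K" using G by (simp add: sym_psd_def)
    have "(\<Sum>q<K. G $$ (p, q)) = 0" if p: "p < K" for p
    proof -
      have "(G *\<^sub>v ones_vec K) $ p = 0" using G(3) p by simp
      then show ?thesis using p Gc by (simp add: ones_vec_def scalar_prod_def atLeast0LessThan)
    qed
    then show ?thesis unfolding h_def autocorr_dcos[OF K] by (simp add: dcos_def dsin_def)
  qed
  have dec: "autocorr K G k = (\<Sum>l=1..K div 2. \<nu> l * dcos K l k)" for k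
  proof -
    have "real K * autocorr K G k = (\<Sum>l<K. h l * dcos K l k)"
      unfolding h_def
      using dcos_inversion[OF K periodic_autocorr autocorr_even[OF K G(1)]] by simp
    also have "{..<K} = insert 0 {1..<K}" using K by auto
    also have "(\<Sum>l\<in>insert 0 {1..<K}. h l * dcos K l k) = (\<Sum>l\<in>{1..<K}. h l * dcos K l k)"
      using h0 by simp
    also have "\<dots> = (\<Sum>l=1..K div 2. (if 2 * l = K then 1 else 2) * (h l * dcos K l k))"
      using K by (intro sum_fold_symmetric) (simp add: h_def dcos_reflect)
    also have "\<dots> = real K * (\<Sum>l=1..K div 2. \<nu> l * dcos K l k)"
      using K by (simp add: sum_distrib_left \<nu>_def mult.assoc)
    finally show ?thesis using K by simp
  qed
  have "\<exists>l\<in>{1..K div 2}. \<nu> l \<noteq> 0"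
  proof (rule ccontr)
    assume "\<not> ?thesis"
    \<comment> \<open>Lag 0 gives the trace, and a positive semidefinite matrix of trace 0
      vanishes.\<close>
    then have "autocorr K G 0 = 0" by (simp add: dec)
    then have "(\<Sum>i<K. G $$ (i, i)) = 0" by (simp add: autocorr_def per_mat_nat)
    then show False using sym_psd_trace_0[OF G(1)] G(2) by simp
  qed
  moreover have "0 \<le> \<nu> l" for l using h_nonneg by (simp add: \<nu>_def)
  ultimately show ?thesis using dec by blast
qed

subsection \<open>The equivalences\<close>

lemma sum_rotate:
  fixes f :: "'a \<Rightarrow> 'b \<Rightarrow> 'c \<Rightarrow> 'd::comm_monoid_add"
  shows "(\<Sum>a\<in>A. \<Sum>b\<in>B. \<Sum>c\<in>C. f a b c) = (\<Sum>b\<in>B. \<Sum>c\<in>C. \<Sum>a\<in>A. f a b c)"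
proof -
  have "(\<Sum>a\<in>A. \<Sum>b\<in>B. \<Sum>c\<in>C. f a b c) = (\<Sum>b\<in>B. \<Sum>a\<in>A. \<Sum>c\<in>C. f a b c)"
    by (rule sum.swap)
  also have "\<dots> = (\<Sum>b\<in>B. \<Sum>c\<in>C. \<Sum>a\<in>A. f a b c)"
    by (rule sum.cong[OF refl]) (rule sum.swap)
  finally show ?thesis .
qed

lemma sum_even_odd: "(\<Sum>k<2 * n. f k) = (\<Sum>l<n. f (2 * l) + f (2 * l + 1))"
  for f :: "nat \<Rightarrow> 'a::comm_monoid_add"
  by (induction n) (simp_all add: add.assoc)

section \<open>From a cycle to a Gram matrix\<close>

lemma hb_grad_eq_iff:
  "\<gamma> \<noteq> 0 \<Longrightarrow> hb_grad \<gamma> \<beta> X i = g \<longleftrightarrow> X (i + 1) = X i - \<gamma> * g + \<beta> * (X i - X (i - 1))"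
  by (auto simp: hb_grad_def field_simps)

lemma interp_form_diag:
  "interp_form \<mu> L \<gamma> \<beta> i j X X = hb_grad \<gamma> \<beta> X j * (X i - X j) + 1 / (2 * L) * (hb_grad \<gamma> \<beta> X i - hb_grad \<gamma> \<beta> X j)\<^sup>2
    + \<mu> / (2 * (1 - \<mu> / L)) * ((X i - X j) - 1 / L * (hb_grad \<gamma> \<beta> X i - hb_grad \<gamma> \<beta> X j))\<^sup>2"
  by (simp add: interp_form_def Let_def power2_eq_square)

lemma HB_cycles_grad:
  assumes "0 < \<gamma>" "K > 0" and cyc: "HB_cycles d \<gamma> \<beta> f K x"
    and xc: "\<And>i. i < K \<Longrightarrow> x i \<in> carrier_vec d"
    and gc: "\<And>i. i < K \<Longrightarrow> grad d f (x i) \<in> carrier_vec d"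
    and "i < K" "k < d"
  shows "grad d f (x i) $ k = hb_grad \<gamma> \<beta> (\<lambda>m. x (nat (m mod int K)) $ k) (int i)"
proof -
  have hb: "HB d \<gamma> \<beta> f (x 0) (x 1) t = x (t mod K)" for t using cyc by (simp add: HB_cycles_def)
  have i: "Suc (i + K - 1) mod K = i" using assms by simp
  \<comment> \<open>The step is read one period later, at time \<open>i + K - 1\<close>, so that
    index 0 also has a predecessor among the naturals.\<close>
  have eq: "x (Suc (Suc (i + K - 1)) mod K) = (x i - \<gamma> \<cdot>\<^sub>v grad d f (x i)) + \<beta> \<cdot>\<^sub>v (x i - x ((i + K - 1) mod K))"
    using HB.simps(3)[of d \<gamma> \<beta> f "x 0" "x 1" "i + K - 1"] unfolding hb i .
  have n1: "Suc (Suc (i + K - 1)) mod K = nat ((int i + 1) mod int K)"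
  proof -
    have "int (Suc (Suc (i + K - 1))) = int i + 1 + int K" using assms by simp
    then have "int (Suc (Suc (i + K - 1))) mod int K = (int i + 1) mod int K" by (metis mod_add_self2)
    then show ?thesis by (simp only: nat_mod_as_int)
  qed
  have n2: "(i + K - 1) mod K = nat ((int i - 1) mod int K)"
  proof -
    have "int (i + K - 1) = int i - 1 + int K" using assms by simp
    then have "int (i + K - 1) mod int K = (int i - 1) mod int K" by (metis mod_add_self2)
    then show ?thesis by (simp only: nat_mod_as_int)
  qed
  have c: "x (nat (m mod int K)) \<in> carrier_vec d" for m using assms by (intro xc) (simp add: nat_less_iff)
  have "x (nat ((int i + 1) mod int K)) $ k = x i $ k - \<gamma> * grad d f (x i) $ k
      + \<beta> * (x i $ k - x (nat ((int i - 1) mod int K)) $ k)"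
    using arg_cong[OF eq, of "\<lambda>v. v $ k"] c[of "int i - 1"] xc[OF assms(6)] gc[OF assms(6)] assms(7)
    unfolding n1 n2 by simp
  then show ?thesis using assms by (subst eq_commute, subst hb_grad_eq_iff) auto
qed

text \<open>The quadratic form is a sum of squares, one per coordinate; centering makes the row sums
  vanish.\<close>

lemma gram_of_points:
  fixes X :: "nat \<Rightarrow> nat \<Rightarrow> real" and d K :: nat
  defines "G \<equiv> mat K K (\<lambda>(p, q). \<Sum>k<d. X k p * X k q)"
  assumes cen: "\<And>k. k < d \<Longrightarrow> (\<Sum>p<K. X k p) = 0"
  shows "sym_psd K G" "G *\<^sub>v ones_vec K = 0\<^sub>v K"
proof -
  have Gc: "G \<in> carrier_mat K K" by (simp add: G_def)
  have "0 \<le> v \<bullet> (G *\<^sub>v v)" if v: "v \<in> carrier_vec K" for v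
  proof -
    have "v \<bullet> (G *\<^sub>v v) = (\<Sum>p<K. \<Sum>q<K. \<Sum>k<d. (v $ p * X k p) * (v $ q * X k q))"
      unfolding quadratic_form_sum[OF Gc v]
      by (intro sum.cong refl) (simp add: G_def sum_distrib_left mult_ac)
    also have "\<dots> = (\<Sum>k<d. \<Sum>p<K. \<Sum>q<K. (v $ p * X k p) * (v $ q * X k q))"
      by (rule sum_rotate[symmetric])
    also have "\<dots> = (\<Sum>k<d. (\<Sum>p<K. v $ p * X k p)\<^sup>2)"
      by (simp add: power2_eq_square sum_product)
    finally show ?thesis by (simp add: sum_nonneg)
  qed
  then show "sym_psd K G" unfolding sym_psd_def by (auto simp: G_def mult.commute intro!: eq_matI)
  show "G *\<^sub>v ones_vec K = 0\<^sub>v K"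
  proof (rule eq_vecI)
    fix p assume "p < dim_vec (0\<^sub>v K :: real vec)"
    then have p: "p < K" by simp
    have "(G *\<^sub>v ones_vec K) $ p = (\<Sum>q<K. \<Sum>k<d. X k p * X k q)"
      using p by (simp add: G_def ones_vec_def scalar_prod_def atLeast0LessThan)
    also have "\<dots> = (\<Sum>k<d. X k p * (\<Sum>q<K. X k q))"
      unfolding sum_distrib_left by (rule sum.swap)
    finally show "(G *\<^sub>v ones_vec K) $ p = 0\<^sub>v K $ p" using p cen by simp
  qed (simp add: G_def)
qed

lemma scalar_prod_unit_diff:
  fixes F :: "real vec"
  assumes "F \<in> carrier_vec K" "i < K" "j < K"
  shows "scalar_prod F (unit_vec K i - unit_vec K j) = F $ i - F $ j"
  using assms by (simp add: scalar_prod_minus_distrib[of _ K])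

text \<open>\<open>G\<close> is the Gram matrix of the centered points and \<open>F\<close> lists
  the values of \<open>f\<close> on the cycle, so the claim becomes the interpolation
  inequality.\<close>

lemma cycle_imp_gram:
  assumes \<mu>: "0 < \<mu>" "\<mu> < L" and \<gamma>: "0 < \<gamma>" and K: "2 \<le> K"
    and xc: "\<And>i. i < K \<Longrightarrow> x i \<in> carrier_vec d" and ne: "i0 < K" "j0 < K" "x i0 \<noteq> x j0"
    and f: "f \<in> F_class d \<mu> L" and cyc: "HB_cycles d \<gamma> \<beta> f K x"
  shows "\<exists>G F. sym_psd K G \<and> G \<noteq> 0\<^sub>m K K \<and> G *\<^sub>v ones_vec K = 0\<^sub>v K \<and>
             F \<in> carrier_vec K \<and>
             (\<forall>i<K. \<forall>j<K. scalar_prod F (unit_vec K i - unit_vec K j)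
                \<ge> mat_inner G (M_mat K \<mu> L \<gamma> \<beta> i j))"
proof -
  have K0: "K > 0" using K by simp
  define Y where "Y k m = x (nat (m mod int K)) $ k" for k m
  define c where "c k = (\<Sum>p<K. Y k (int p)) / real K" for k
  define X where "X k m = Y k m - c k" for k and m :: int
  have per: "periodic K (X k)" for k by (simp add: periodic_def X_def Y_def)
  have Yi: "Y k (int i) = x i $ k" if "i < K" for i k using that by (simp add: Y_def flip: of_nat_mod)
  define G where "G = mat K K (\<lambda>(p, q). \<Sum>k<d. X k (int p) * X k (int q))"
  have "(\<Sum>p<K. X k (int p)) = 0" for k
    using K0 by (simp add: X_def sum_subtractf c_def)
  note G = gram_of_points[of d "\<lambda>k p. X k (int p)" K, OF this, folded G_def]
  have Gne: "G \<noteq> 0\<^sub>m K K"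
  proof
    assume G0: "G = 0\<^sub>m K K"
    \<comment> \<open>The diagonal of \<open>G\<close> holds the squared norms; if they vanish, all
      points coincide with their mean.\<close>
    have "X k (int p) = 0" if "p < K" "k < d" for p k
    proof -
      have "G $$ (p, p) = 0" using G0 that by simp
      then have "(\<Sum>k<d. X k (int p) * X k (int p)) = 0" using that by (simp add: G_def)
      then show ?thesis using that by (simp add: sum_nonneg_eq_0_iff)
    qed
    then have "x p $ k = c k" if "p < K" "k < d" for p k using that Yi by (fastforce simp: X_def)
    then have "x i0 = x j0" using ne xc[OF ne(1)] xc[OF ne(2)] by (intro eq_vecI) auto
    with ne show False by simp
  qed
  define F where "F = vec K (\<lambda>i. f (x i))"
  have "scalar_prod F (unit_vec K i - unit_vec K j) \<ge> mat_inner G (M_mat K \<mu> L \<gamma> \<beta> i j)"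
    if ij: "i < K" "j < K" for i j
  proof -
    have qb: "quad_bounds d \<mu> L f (x i) (grad d f (x i))" if "i < K" for i
      using F_class_quad_bounds[OF f xc[OF that]] .
    then have gc: "grad d f (x i) \<in> carrier_vec d" if "i < K" for i using that by (simp add: quad_bounds_def)
    have g: "grad d f (x i) $ k = hb_grad \<gamma> \<beta> (X k) (int i)" if "i < K" "k < d" for i k
    proof -
      have "grad d f (x i) $ k = hb_grad \<gamma> \<beta> (Y k) (int i)"
        unfolding Y_def using HB_cycles_grad[OF \<gamma> K0 cyc xc gc that] .
      \<comment> \<open>Constants are annihilated, since
        \<open>(1 + \<beta>) - 1 - \<beta> = 0\<close>; centering therefore leaves the gradients
        unchanged.\<close>
      also have "\<dots> = hb_grad \<gamma> \<beta> (X k) (int i)" by (simp add: hb_grad_def X_def algebra_simps)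
      finally show ?thesis .
    qed
    have xd: "x i $ k - x j $ k = X k (int i) - X k (int j)" for k using ij by (simp add: X_def Yi)
    have "mat_inner G (M_mat K \<mu> L \<gamma> \<beta> i j) = (\<Sum>k<d. interp_form \<mu> L \<gamma> \<beta> (int i) (int j) (X k) (X k))"
      by (intro mat_inner_Gram K0 per) (auto simp: G_def)
    also have "\<dots> = (\<Sum>k<d. grad d f (x j) $ k * (x i $ k - x j $ k)
        + 1 / (2 * L) * (grad d f (x i) $ k - grad d f (x j) $ k)\<^sup>2
        + \<mu> / (2 * (1 - \<mu> / L)) * ((x i $ k - x j $ k) - 1 / L * (grad d f (x i) $ k - grad d f (x j) $ k))\<^sup>2)"
      using ij by (intro sum.cong refl) (simp add: interp_form_diag g xd)
    also have "\<dots> \<le> f (x i) - f (x j)"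
      using \<mu> qb[OF ij(1)] qb[OF ij(2)] ij
      by (intro interpolation_inequality xc gc) (auto simp: quad_bounds_def)
    also have "\<dots> = scalar_prod F (unit_vec K i - unit_vec K j)"
      using ij by (simp add: scalar_prod_unit_diff F_def)
    finally show ?thesis .
  qed
  moreover have "F \<in> carrier_vec K" by (simp add: F_def)
  ultimately show ?thesis using G Gne by blast
qed

section \<open>Circulant matrices and the way back to a cycle\<close>

lemma H_mat_carrier: "H_mat K l \<in> carrier_mat K K"
  by (simp add: H_mat_def)

lemma index_H_mat: "p < K \<Longrightarrow> q < K \<Longrightarrow> H_mat K l $$ (p, q) = dcos K l (int p - int q)"
proof -
  have "cos (c * \<bar>r\<bar> / k) = cos (c * r / k)" for c r k :: real by (simp add: abs_if)
  then show "p < K \<Longrightarrow> q < K \<Longrightarrow> H_mat K l $$ (p, q) = dcos K l (int p - int q)"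
    by (simp add: H_mat_def dcos_def)
qed

lemma H_mat_combination:
  assumes "K > 0"
  shows "(\<Sum>l=1..n. \<nu> l * mat_inner (H_mat K l) (M_mat K \<mu> L \<gamma> \<beta> i j)) =
    (\<Sum>p<K. \<Sum>q<K. (\<Sum>l=1..n. \<nu> l * dcos K l (int p - int q))
       * cyc_form K \<mu> L \<gamma> \<beta> (int i) (int j) (int p) (int q))"
proof -
  let ?c = "\<lambda>p q. cyc_form K \<mu> L \<gamma> \<beta> (int i) (int j) (int p) (int q)"
  have "(\<Sum>l=1..n. \<nu> l * mat_inner (H_mat K l) (M_mat K \<mu> L \<gamma> \<beta> i j))
     = (\<Sum>l=1..n. \<Sum>p<K. \<Sum>q<K. \<nu> l * dcos K l (int p - int q) * ?c p q)"
    by (simp add: mat_inner_M_mat[OF assms H_mat_carrier] index_H_mat sum_distrib_left mult.assoc)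
  also have "\<dots> = (\<Sum>p<K. \<Sum>q<K. \<Sum>l=1..n. \<nu> l * dcos K l (int p - int q) * ?c p q)"
    by (rule sum_rotate)
  finally show ?thesis by (simp add: sum_distrib_right)
qed

text \<open>The inequalities for the pairs \<open>(i + s, s)\<close> are summed over all shifts
  \<open>s\<close>. On one side the shifted copies of \<open>G\<close> add up to the circulant
  matrix of \<open>autocorr\<close>, on the other the values of \<open>F\<close> cancel.\<close>

lemma gram_imp_circulant:
  assumes K: "2 \<le> K"
    and G: "sym_psd K G" "G \<noteq> 0\<^sub>m K K" "G *\<^sub>v ones_vec K = 0\<^sub>v K"
    and F: "F \<in> carrier_vec K" "\<And>i j. i < K \<Longrightarrow> j < K \<Longrightarrow> scalar_prod F (unit_vec K i - unit_vec K j)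
                \<ge> mat_inner G (M_mat K \<mu> L \<gamma> \<beta> i j)"
  shows "\<exists>\<nu>\<in>carrier_vec (K div 2). \<nu> \<ge> 0\<^sub>v (K div 2) \<and> \<nu> \<noteq> 0\<^sub>v (K div 2) \<and>
             (\<forall>i<K. 0 \<ge> (\<Sum>l = 1..K div 2.
                vec_index \<nu> (l - 1) * mat_inner (H_mat K l) (M_mat K \<mu> L \<gamma> \<beta> i 0)))"
proof -
  have K0: "K > 0" using K by simp
  obtain \<nu> where \<nu>: "\<And>l. 0 \<le> \<nu> l" "\<exists>l\<in>{1..K div 2}. \<nu> l \<noteq> 0"
    "\<And>k. autocorr K G k = (\<Sum>l=1..K div 2. \<nu> l * dcos K l k)"
    using autocorr_cosine_decomposition[OF K0 G] by blast
  \<comment> \<open>Vector positions start at 0, frequencies at 1.\<close>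
  define w where "w = vec (K div 2) (\<lambda>l. \<nu> (l + 1))"
  have "(\<Sum>l=1..K div 2. vec_index w (l - 1) * mat_inner (H_mat K l) (M_mat K \<mu> L \<gamma> \<beta> i 0)) \<le> 0"
    if i: "i < K" for i
  proof -
    let ?c = "\<lambda>p q. cyc_form K \<mu> L \<gamma> \<beta> (int i) 0 (int p) (int q)"
    have Gc: "G \<in> carrier_mat K K" using G by (simp add: sym_psd_def)
    define \<phi> where "\<phi> m = F $ nat (m mod int K)" for m
    have \<phi>: "periodic K \<phi>" by (simp add: periodic_def \<phi>_def)
    have ineq: "(\<Sum>p<K. \<Sum>q<K. per_mat K G (int p + int s) (int q + int s) * ?c p q) \<le> \<phi> (int s + int i) - \<phi> (int s)"
      if s: "s < K" for s
    proof -
      \<comment> \<open>\<open>r\<close> is \<open>i + s\<close> reduced modulo \<open>K\<close>, a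
        legitimate index for the assumed inequality.\<close>
      define r where "r = nat ((int i + int s) mod int K)"
      have r: "r < K" "int r = (int i + int s) mod int K" using K0 by (auto simp: r_def nat_less_iff)
      have s': "int s = (0 + int s) mod int K" using s by simp
      have "mat_inner G (M_mat K \<mu> L \<gamma> \<beta> r s)
        = (\<Sum>p<K. \<Sum>q<K. per_mat K G (int p) (int q) * cyc_form K \<mu> L \<gamma> \<beta> (int r) (int s) (int p) (int q))"
        using K0 by (simp add: mat_inner_M_mat[OF K0 Gc] per_mat_nat)
      also have "\<dots> = (\<Sum>p<K. \<Sum>q<K. per_mat K G (int p) (int q)
          * cyc_form K \<mu> L \<gamma> \<beta> (int i + int s) (0 + int s) (int p) (int q))"
        by (subst s') (simp only: r(2) cyc_form_mod)
      also have "\<dots> = (\<Sum>p<K. \<Sum>q<K. per_mat K G (int p + int s) (int q + int s) * ?c p q)"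
        by (rule sum_cyc_form_shift[OF K0 periodic_per_mat])
      finally have "(\<Sum>p<K. \<Sum>q<K. per_mat K G (int p + int s) (int q + int s) * ?c p q)
          \<le> scalar_prod F (unit_vec K r - unit_vec K s)" using F(2)[OF r(1) s] by simp
      also have "\<dots> = \<phi> (int s + int i) - \<phi> (int s)"
        using s r F(1) by (simp add: scalar_prod_unit_diff \<phi>_def r_def add.commute flip: of_nat_mod)
      finally show ?thesis .
    qed
    have "(\<Sum>l=1..K div 2. vec_index w (l - 1) * mat_inner (H_mat K l) (M_mat K \<mu> L \<gamma> \<beta> i 0))
       = (\<Sum>l=1..K div 2. \<nu> l * mat_inner (H_mat K l) (M_mat K \<mu> L \<gamma> \<beta> i 0))"
      by (intro sum.cong refl) (auto simp: w_def)
    also have "\<dots> = (\<Sum>p<K. \<Sum>q<K. autocorr K G (int p - int q) * ?c p q)"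
      unfolding H_mat_combination[OF K0] \<nu>(3) by simp
    also have "\<dots> = (\<Sum>p<K. \<Sum>q<K. \<Sum>s<K. per_mat K G (int p + int s) (int q + int s) * ?c p q)"
      by (simp only: autocorr_diff[OF K0, symmetric] sum_distrib_right)
    also have "\<dots> = (\<Sum>s<K. \<Sum>p<K. \<Sum>q<K. per_mat K G (int p + int s) (int q + int s) * ?c p q)"
      by (rule sum_rotate[symmetric])
    also have "\<dots> \<le> (\<Sum>s<K. \<phi> (int s + int i) - \<phi> (int s))" by (intro sum_mono ineq) auto
    \<comment> \<open>A sum over one period is invariant under shifting, so the function values
      cancel.\<close>
    also have "\<dots> = 0" using sum_periodic_shift[OF K0 \<phi>, of "int i"] by (simp add: sum_subtractf)
    finally show ?thesis .
  qed
  moreover have "w \<ge> 0\<^sub>v (K div 2)" using \<nu>(1) by (simp add: w_def less_eq_vec_def)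
  moreover have "w \<noteq> 0\<^sub>v (K div 2)"
  proof
    assume w0: "w = 0\<^sub>v (K div 2)"
    obtain l where l: "l \<in> {1..K div 2}" "\<nu> l \<noteq> 0" using \<nu>(2) by blast
    then have "w $ (l - 1) = \<nu> l" by (auto simp: w_def)
    then show False using w0 l by auto
  qed
  moreover have "w \<in> carrier_vec (K div 2)" by (simp add: w_def)
  ultimately show ?thesis by blast
qed

text \<open>The points wind around circles, one for each frequency, with radius \<open>sqrt\<close>
  of its weight. By rotational symmetry all function values can be taken to be 0.\<close>

lemma circulant_imp_cycle:
  assumes \<mu>: "0 < \<mu>" "\<mu> < L" and \<gamma>: "0 < \<gamma>" and K: "2 \<le> K"
    and \<nu>: "\<nu> \<in> carrier_vec (K div 2)" "\<nu> \<ge> 0\<^sub>v (K div 2)" "\<nu> \<noteq> 0\<^sub>v (K div 2)"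
    and neg: "\<And>i. i < K \<Longrightarrow> 0 \<ge> (\<Sum>l = 1..K div 2.
                vec_index \<nu> (l - 1) * mat_inner (H_mat K l) (M_mat K \<mu> L \<gamma> \<beta> i 0))"
  shows "\<exists>d\<ge>1. \<exists>x. (\<forall>i<K. x i \<in> carrier_vec d) \<and>
             (\<exists>i<K. \<exists>j<K. x i \<noteq> x j) \<and>
             (\<exists>f\<in>F_class d \<mu> L. HB_cycles d \<gamma> \<beta> f K x)"
proof -
  have K0: "K > 0" using K by simp
  define n where "n = K div 2"
  define d where "d = 2 * n"
  have \<nu>0: "0 \<le> \<nu> $ l" if "l < n" for l using \<nu> that by (simp add: less_eq_vec_def n_def)
  \<comment> \<open>Coordinates \<open>2 * l\<close> and \<open>2 * l + 1\<close> carry the cosine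
    and sine of frequency \<open>l + 1\<close>.\<close>
  define X where "X k m = sqrt (\<nu> $ (k div 2)) * (if even k then dcos K (k div 2 + 1) m else dsin K (k div 2 + 1) m)" for k m
  have per: "periodic K (X k)" for k
    unfolding periodic_def X_def using periodicD[OF periodic_dcos[OF K0]] periodicD[OF periodic_dsin[OF K0]] by simp
  have gram: "(\<Sum>k<d. X k p * X k q) = (\<Sum>l=1..n. \<nu> $ (l - 1) * dcos K l (p - q))" for p q
  proof -
    have "(\<Sum>k<d. X k p * X k q) = (\<Sum>l<n. \<nu> $ l * dcos K (l + 1) (p - q))"
      unfolding d_def sum_even_odd
    proof (intro sum.cong refl)
      fix l assume "l \<in> {..<n}"
      then have *: "sqrt (\<nu> $ l) * sqrt (\<nu> $ l) = \<nu> $ l" using \<nu>0 by simp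
      show "X (2 * l) p * X (2 * l) q + X (2 * l + 1) p * X (2 * l + 1) q = \<nu> $ l * dcos K (l + 1) (p - q)"
      proof -
        have "r * a * (r * b) + r * c * (r * e) = (r * r) * (a * b + c * e)" for r a b c e :: real
          by (simp add: algebra_simps)
        moreover have "X (2 * l) m = sqrt (\<nu> $ l) * dcos K (l + 1) m"
          "X (2 * l + 1) m = sqrt (\<nu> $ l) * dsin K (l + 1) m" for m
          by (simp_all add: X_def)
        ultimately show ?thesis using * by (simp only: dcos_diff)
      qed
    qed
    also have "\<dots> = (\<Sum>l=1..n. \<nu> $ (l - 1) * dcos K l (p - q))"
      by (rule sum.reindex_bij_witness[of _ "\<lambda>l. l - 1" Suc]) auto
    finally show ?thesis .
  qed
  \<comment> \<open>The hypothesis covers only second index 0. Shifting by \<open>j\<close> reduces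
    a general pair to \<open>(i - j, 0)\<close>, and the Gram entries survive the shift because they
    depend on \<open>p - q\<close> alone.\<close>
  have le0: "(\<Sum>k<d. interp_form \<mu> L \<gamma> \<beta> i j (X k) (X k)) \<le> 0" for i j
  proof -
    define r where "r = nat ((i - j) mod int K)"
    have r: "r < K" "int r = (i - j) mod int K" using K0 by (auto simp: r_def nat_less_iff)
    have "(\<Sum>k<d. interp_form \<mu> L \<gamma> \<beta> i j (X k) (X k))
      = (\<Sum>k<d. interp_form \<mu> L \<gamma> \<beta> (i - j) 0 (\<lambda>m. X k (m + j)) (\<lambda>m. X k (m + j)))"
      using interp_form_shift[of \<mu> L \<gamma> \<beta> "i - j" j 0] by simp
    also have "\<dots> = (\<Sum>k<d. \<Sum>p<K. \<Sum>q<K. X k (int p + j) * X k (int q + j) * cyc_form K \<mu> L \<gamma> \<beta> (i - j) 0 (int p) (int q))"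
    proof (intro sum.cong refl interp_form_expand K0)
      fix k show "periodic K (\<lambda>m. X k (m + j))"
        unfolding periodic_def by (auto intro: periodic_cong[OF per] simp: mod_simps)
    qed
    also have "\<dots> = (\<Sum>p<K. \<Sum>q<K. \<Sum>k<d. X k (int p + j) * X k (int q + j) * cyc_form K \<mu> L \<gamma> \<beta> (i - j) 0 (int p) (int q))"
      by (rule sum_rotate)
    also have "\<dots> = (\<Sum>p<K. \<Sum>q<K. (\<Sum>l=1..n. \<nu> $ (l - 1) * dcos K l (int p - int q))
        * cyc_form K \<mu> L \<gamma> \<beta> (int r) (int 0) (int p) (int q))"
    proof -
      have "cyc_form K \<mu> L \<gamma> \<beta> (int r) (int 0) p q = cyc_form K \<mu> L \<gamma> \<beta> (i - j) 0 p q" for p q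
        using cyc_form_mod[of K \<mu> L \<gamma> \<beta> "i - j" 0] r by simp
      then show ?thesis by (simp add: gram flip: sum_distrib_right)
    qed
    also have "\<dots> = (\<Sum>l=1..n. \<nu> $ (l - 1) * mat_inner (H_mat K l) (M_mat K \<mu> L \<gamma> \<beta> r 0))"
      by (rule H_mat_combination[OF K0, symmetric])
    also have "\<dots> \<le> 0" using neg[OF r(1)] by (simp add: n_def)
    finally show ?thesis .
  qed
  define x where "x i = vec d (\<lambda>k. X k (int i))" for i
  define g where "g i = vec d (\<lambda>k. hb_grad \<gamma> \<beta> (X k) (int i))" for i
  have "\<exists>f\<in>F_class d \<mu> L. \<forall>i<K. f (x i) = 0 \<and> grad d f (x i) = g i"
  proof (rule strongly_convex_interpolation[OF \<mu> K0])
    fix i j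
    have "(\<Sum>k<d. g j $ k * (x i $ k - x j $ k) + 1 / (2 * L) * (g i $ k - g j $ k)\<^sup>2
      + \<mu> / (2 * (1 - \<mu> / L)) * ((x i $ k - x j $ k) - 1 / L * (g i $ k - g j $ k))\<^sup>2)
      = (\<Sum>k<d. interp_form \<mu> L \<gamma> \<beta> (int i) (int j) (X k) (X k))"
      by (intro sum.cong refl) (simp add: interp_form_diag x_def g_def)
    also have "\<dots> \<le> 0 - 0" using le0 by simp
    finally show "(\<Sum>k<d. g j $ k * (x i $ k - x j $ k) + 1 / (2 * L) * (g i $ k - g j $ k)\<^sup>2
      + \<mu> / (2 * (1 - \<mu> / L)) * ((x i $ k - x j $ k) - 1 / L * (g i $ k - g j $ k))\<^sup>2) \<le> (0::real) - 0" .
  qed (simp_all add: x_def g_def)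
  then obtain f where f: "f \<in> F_class d \<mu> L" and gr: "\<And>i. i < K \<Longrightarrow> grad d f (x i) = g i" by blast
  \<comment> \<open>\<open>x\<close> is defined at every natural number, so the iterates are first
    compared with \<open>x t\<close> and reduced modulo \<open>K\<close> only at the end.\<close>
  have xm: "x t = x (t mod K)" for t
    unfolding x_def by (intro eq_vecI) (auto intro: periodic_cong[OF per] simp: zmod_int)
  have gm: "g t = g (t mod K)" for t
    unfolding g_def by (intro eq_vecI) (auto intro: periodic_cong[OF periodic_hb_grad[OF per]] simp: zmod_int)
  have gt: "grad d f (x t) = g t" for t using gr[of "t mod K"] xm[of t] gm[of t] K0 by simp
  have HB: "HB d \<gamma> \<beta> f (x 0) (x 1) t = x t" for t
  proof (induction t rule: induct_nat_012)
    case (ge2 t)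
    have "X k (int (Suc t) + 1) = X k (int (Suc t)) - \<gamma> * hb_grad \<gamma> \<beta> (X k) (int (Suc t))
        + \<beta> * (X k (int (Suc t)) - X k (int (Suc t) - 1))" for k
      using hb_grad_eq_iff[of \<gamma> \<beta> "X k" "int (Suc t)"] \<gamma> by blast
    then have "X k (int (Suc (Suc t))) = X k (int (Suc t)) - \<gamma> * hb_grad \<gamma> \<beta> (X k) (int (Suc t))
        + \<beta> * (X k (int (Suc t)) - X k (int t))" for k
      by (simp add: add.commute add.left_commute)
    then show ?case unfolding HB.simps ge2.IH gt by (intro eq_vecI) (simp_all add: x_def g_def)
  qed simp_all
  have ne: "x 0 \<noteq> x 1"
  proof
    assume eq: "x 0 = x 1"
    have X01: "X k 0 = X k 1" if "k < d" for k
      using arg_cong[OF eq, of "\<lambda>v. v $ k"] that by (simp add: x_def)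
    obtain l where l: "l < n" "\<nu> $ l \<noteq> 0"
    proof -
      have "\<exists>l<n. \<nu> $ l \<noteq> 0"
      proof (rule ccontr)
        assume "\<not> ?thesis"
        then have "\<nu> = 0\<^sub>v (K div 2)" using \<nu>(1) by (intro eq_vecI) (auto simp: n_def)
        with \<nu>(3) show False by simp
      qed
      then show ?thesis using that by blast
    qed
    \<comment> \<open>The cosine coordinate of an active frequency separates \<open>x 0\<close> from
      \<open>x 1\<close>, since \<open>0 < l + 1 < K\<close>.\<close>
    have "X (2 * l) 0 = X (2 * l) 1" using l by (intro X01) (simp add: d_def)
    then have "dcos K (l + 1) 1 = 1" using l by (simp add: X_def dcos_def)
    moreover have "l + 1 < K" using l K by (simp add: n_def)
    ultimately show False using dcos_ne_1[of "l + 1" K] by simp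
  qed
  have "HB_cycles d \<gamma> \<beta> f K x"
    unfolding HB_cycles_def
  proof (intro conjI allI)
    show "\<exists>i<K. \<exists>j<K. x i \<noteq> x j" using ne K by (intro exI[of _ 0] exI[of _ 1] conjI) auto
    show "HB d \<gamma> \<beta> f (x 0) (x 1) t = x (t mod K)" for t using HB xm by simp
  qed
  moreover have "1 \<le> d" using K by (simp add: d_def n_def)
  moreover have "\<exists>i<K. \<exists>j<K. x i \<noteq> x j"
    using calculation by (simp add: HB_cycles_def)
  moreover have "\<forall>i<K. x i \<in> carrier_vec d" by (simp add: x_def)
  ultimately show ?thesis using f by blast
qed

text \<open>Each component of the matrix-vector product is the displayed sum, after shifting the
  column index by one and exchanging the arguments of \<open>mat_inner\<close>.\<close>

lemma circulant_iff_linear_system: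
  assumes \<nu>: "\<nu> \<in> carrier_vec (K div 2)"
  shows "(\<forall>i<K. 0 \<ge> (\<Sum>l = 1..K div 2. vec_index \<nu> (l - 1) * mat_inner (H_mat K l) (M_mat K \<mu> L \<gamma> \<beta> i 0)))
    \<longleftrightarrow> P_mat K \<mu> L \<gamma> \<beta> *\<^sub>v \<nu> \<le> 0\<^sub>v K"
proof -
  have "(P_mat K \<mu> L \<gamma> \<beta> *\<^sub>v \<nu>) $ i =
     (\<Sum>l = 1..K div 2. vec_index \<nu> (l - 1) * mat_inner (H_mat K l) (M_mat K \<mu> L \<gamma> \<beta> i 0))" if "i < K" for i
  proof -
    have "(P_mat K \<mu> L \<gamma> \<beta> *\<^sub>v \<nu>) $ i =
        (\<Sum>l<K div 2. mat_inner (M_mat K \<mu> L \<gamma> \<beta> i 0) (H_mat K (l + 1)) * \<nu> $ l)"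
      using that \<nu> by (simp add: P_mat_def scalar_prod_def atLeast0LessThan)
    also have "\<dots> = (\<Sum>l = 1..K div 2. vec_index \<nu> (l - 1) * mat_inner (H_mat K l) (M_mat K \<mu> L \<gamma> \<beta> i 0))"
      by (rule sum.reindex_bij_witness[of _ "\<lambda>l. l - 1" Suc])
         (auto simp: mat_inner_comm[OF M_mat_carrier H_mat_carrier])
    finally show ?thesis .
  qed
  then show ?thesis by (auto simp: less_eq_vec_def P_mat_def)
qed

theorem theorem6p13:
  fixes \<mu> L \<gamma> \<beta> :: real and K :: nat
  assumes "0 < \<mu>" and "\<mu> < L"
    and "(\<gamma>, \<beta>) \<in> Omega_cv_Q \<mu> L"
    and "2 \<le> K"
  defines "cycle \<equiv> (\<exists>d\<ge>1. \<exists>x. (\<forall>i<K. x i \<in> carrier_vec d) \<and>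
             (\<exists>i<K. \<exists>j<K. x i \<noteq> x j) \<and>
             (\<exists>f\<in>F_class d \<mu> L. HB_cycles d \<gamma> \<beta> f K x))"
    and "gram \<equiv> (\<exists>G F. sym_psd K G \<and> G \<noteq> 0\<^sub>m K K \<and> G *\<^sub>v ones_vec K = 0\<^sub>v K \<and>
             F \<in> carrier_vec K \<and>
             (\<forall>i<K. \<forall>j<K. scalar_prod F (unit_vec K i - unit_vec K j)
                \<ge> mat_inner G (M_mat K \<mu> L \<gamma> \<beta> i j)))"
    and "circulant \<equiv> (\<exists>\<nu>\<in>carrier_vec (K div 2). \<nu> \<ge> 0\<^sub>v (K div 2) \<and> \<nu> \<noteq> 0\<^sub>v (K div 2) \<and>
             (\<forall>i<K. 0 \<ge> (\<Sum>l = 1..K div 2.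
                vec_index \<nu> (l - 1) * mat_inner (H_mat K l) (M_mat K \<mu> L \<gamma> \<beta> i 0))))"
    and "linear_system \<equiv> (\<exists>\<nu>\<in>carrier_vec (K div 2). \<nu> \<ge> 0\<^sub>v (K div 2) \<and> \<nu> \<noteq> 0\<^sub>v (K div 2) \<and>
             P_mat K \<mu> L \<gamma> \<beta> *\<^sub>v \<nu> \<le> 0\<^sub>v K)"
  shows "(cycle \<longleftrightarrow> gram) \<and> (gram \<longleftrightarrow> circulant) \<and> (circulant \<longleftrightarrow> linear_system)"
proof -
  have \<gamma>: "0 < \<gamma>" using assms(3) by (simp add: Omega_cv_Q_def)
  have "cycle \<Longrightarrow> gram"
    unfolding cycle_def gram_def using cycle_imp_gram[OF assms(1,2) \<gamma> assms(4)] by blast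
  moreover have "gram \<Longrightarrow> circulant"
    unfolding gram_def circulant_def using gram_imp_circulant[OF assms(4)] by blast
  moreover have "circulant \<Longrightarrow> cycle"
    unfolding circulant_def cycle_def using circulant_imp_cycle[OF assms(1,2) \<gamma> assms(4)] by blast
  moreover have "circulant \<longleftrightarrow> linear_system"
    unfolding circulant_def linear_system_def by (intro bex_cong refl conj_cong circulant_iff_linear_system)
  ultimately show ?thesis by blast
qed

end
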